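(* Consider a sub-Gaussian multi-armed bandit with $K$ arms. For $a>2$ and $0<\delta<1$, let EXP3.P be run with $\gamma=2\sqrt{\frac{3K\ln K}{5T}}$ and $\alpha=2\sqrt{\ln\frac{KT}{\delta}}$. Then there is a function $h(T)=O^*(\sqrt T)$ such that, with probability at least $(1-\delta)\left(1-\frac1{T^a}\right)^T$, $$R_T\le\log(1/\delta)\,h(T).$$
   Context: Multi-armed bandit (MAB): $K$ arms, horizon $T$. At each step $t=1,\dots,T$ there is a reward vector $r^t=(r^t_1,\dots,r^t_K)$; the player pulls an arm $i_t$ and receives (and observes only) $y_t=r^t_{i_t}$. Regret: $R_T=\max_{1\le j\le K}\sum_{t=1}^Tr^t_j-\sum_{t=1}^Ty_t$. Sub-Gaussian MAB: the reward vectors $r^1,\dots,r^T$ are i.i.d. with density $f$ on $\mathbb R^K$, mean vector $\mu=(\mu_1,\dots,\mu_K)$ and covariance matrix $\Sigma=(a_{ij})$, non-degenerate in the sense $\min_ja_{jj}>0$, with sub-Gaussian coordinates. A random variable $X$ is $\sigma^2$-sub-Gaussian if $P(|X|>s)\le Be^{-\sigma^2s^2}$ for every $s>0$, with $B$ a positive constant. Algorithm EXP3.P with parameters $\alpha>0$, $\gamma\in(0,1)$: initialize $w_i(1)=\exp\left(\frac{\alpha\gamma}{3}\sqrt{\frac TK}\right)$, $i=1,\dots,K$. For $t=1,\dots,T$: set $p_i(t)=(1-\gamma)\frac{w_i(t)}{\sum_{j=1}^Kw_j(t)}+\frac\gamma K$; draw $i_t$ from $(p_1(t),\dots,p_K(t))$;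 receive $r^t_{i_t}$; for each $j$ set $\hat x_j(t)=\frac{r^t_j}{p_j(t)}\mathbf 1_{j=i_t}$ and $w_j(t+1)=w_j(t)\exp\left(\frac{\gamma}{3K}\left(\hat x_j(t)+\frac{\alpha}{p_j(t)\sqrt{KT}}\right)\right)$. Notation: $h(T)=O^*(g(T))$ means $h(T)=O(g(T)\log^k g(T))$ as $T\to\infty$ for some integer $k$. *)

theory Defs
  imports "HOL-Probability.Probability" "HOL-Library.Landau_Symbols"
begin

text \<open>
  The number of arms is \<open>K = CARD('k)\<close>. Rounds are numbered from 1, and \<open>r t $ j\<close> is the
  reward of arm \<open>j\<close> in round \<open>t\<close>.
\<close>

definition regret :: "nat \<Rightarrow> (nat \<Rightarrow> real ^ 'k) \<Rightarrow> (nat \<Rightarrow> 'k) \<Rightarrow> real" where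
  "regret T r i = (MAX j. \<Sum>t=1..T. r t $ j) - (\<Sum>t=1..T. r t $ i t)"

text \<open>The parameter \<open>\<sigma>\<close> is in the exponent as an inverse scale, not as a standard deviation.\<close>

definition subgaussian :: "'w measure \<Rightarrow> ('w \<Rightarrow> real) \<Rightarrow> real \<Rightarrow> bool" where
  "subgaussian M X \<sigma> \<longleftrightarrow> X \<in> borel_measurable M \<and>
     (\<exists>B>0. \<forall>s>0. measure M {\<omega> \<in> space M. \<bar>X \<omega>\<bar> > s} \<le> B * exp (- \<sigma>\<^sup>2 * s\<^sup>2))"

definition subgaussian_mab ::
  "(real ^ 'k \<Rightarrow> real) \<Rightarrow> real ^ 'k \<Rightarrow> real ^ 'k ^ 'k \<Rightarrow> bool" where
  "subgaussian_mab f \<mu> C \<longleftrightarrow>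
     (let D = density lborel (\<lambda>x. ennreal (f x)) in
        f \<in> borel_measurable borel \<and> (\<forall>x. f x \<ge> 0) \<and> prob_space D \<and>
        (\<forall>j. \<mu> $ j = (\<integral>x. x $ j \<partial>D)) \<and>
        (\<forall>i j. C $ i $ j = (\<integral>x. (x $ i - \<mu> $ i) * (x $ j - \<mu> $ j) \<partial>D)) \<and>
        (MIN j. C $ j $ j) > 0 \<and>
        (\<forall>j. \<exists>\<sigma>>0. subgaussian D (\<lambda>x. x $ j) \<sigma>))"

definition exp3p_mix :: "real \<Rightarrow> ('k::finite \<Rightarrow> real) \<Rightarrow> 'k \<Rightarrow> real" where
  "exp3p_mix \<gamma> w j = (1 - \<gamma>) * (w j / (\<Sum>l\<in>UNIV. w l)) + \<gamma> / real CARD('k)"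

text \<open>
  \<open>exp3p_weight \<alpha> \<gamma> T r i n\<close> is the weight vector after \<open>n\<close> completed rounds, so that
  \<open>w\<^sub>j(t)\<close> is \<open>exp3p_weight \<alpha> \<gamma> T r i (t - 1) j\<close>. Because of the indicator factor, it
  depends on \<open>r\<close> only through the observed rewards \<open>r s $ i s\<close> with \<open>1 \<le> s \<le> n\<close>.
\<close>

primrec exp3p_weight ::
  "real \<Rightarrow> real \<Rightarrow> nat \<Rightarrow> (nat \<Rightarrow> real ^ 'k) \<Rightarrow> (nat \<Rightarrow> 'k) \<Rightarrow> nat \<Rightarrow> 'k::finite \<Rightarrow> real" where
  "exp3p_weight \<alpha> \<gamma> T r i 0 =
     (\<lambda>j. exp (\<alpha> * \<gamma> / 3 * sqrt (real T / real CARD('k))))"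
| "exp3p_weight \<alpha> \<gamma> T r i (Suc n) =
     (let w = exp3p_weight \<alpha> \<gamma> T r i n;
          p = exp3p_mix \<gamma> w;
          xhat = (\<lambda>j. r (Suc n) $ j / p j * of_bool (j = i (Suc n)))
      in (\<lambda>j. w j * exp (\<gamma> / (3 * real CARD('k)) *
                (xhat j + \<alpha> / (p j * sqrt (real CARD('k) * real T))))))"

definition exp3p_prob ::
  "real \<Rightarrow> real \<Rightarrow> nat \<Rightarrow> (nat \<Rightarrow> real ^ 'k) \<Rightarrow> (nat \<Rightarrow> 'k) \<Rightarrow> nat \<Rightarrow> 'k::finite \<Rightarrow> real" where
  "exp3p_prob \<alpha> \<gamma> T r i t = exp3p_mix \<gamma> (exp3p_weight \<alpha> \<gamma> T r i (t - 1))"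

definition draw_info ::
  "'w measure \<Rightarrow> nat \<Rightarrow> (nat \<Rightarrow> 'w \<Rightarrow> real ^ 'k) \<Rightarrow> (nat \<Rightarrow> 'w \<Rightarrow> 'k) \<Rightarrow> nat \<Rightarrow> 'w measure" where
  "draw_info M T r i t = vimage_algebra (space M)
     (\<lambda>\<omega>. (\<lambda>s\<in>{1..T}. r s \<omega>, \<lambda>s\<in>{1..<t}. i s \<omega>))
     ((\<Pi>\<^sub>M s\<in>{1..T}. borel) \<Otimes>\<^sub>M (\<Pi>\<^sub>M s\<in>{1..<t}. count_space UNIV))"

text \<open>
  A realisation of the interaction on a probability space \<open>M\<close>. The arm of round \<open>t\<close> is drawn
  from \<open>p(t)\<close> with fresh randomness: conditionally on the earlier draws and on the whole
  reward sequence, which is generated independently of the player's randomisation, its law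
  is \<open>p(t)\<close>. Together with the law of the rewards this determines the joint law of
  \<open>(r\<^sup>t, i\<^sub>t)\<close> for \<open>1 \<le> t \<le> T\<close>.
\<close>

definition exp3p_run ::
  "'w measure \<Rightarrow> (real ^ 'k \<Rightarrow> real) \<Rightarrow> real \<Rightarrow> real \<Rightarrow> nat \<Rightarrow>
     (nat \<Rightarrow> 'w \<Rightarrow> real ^ 'k) \<Rightarrow> (nat \<Rightarrow> 'w \<Rightarrow> 'k::finite) \<Rightarrow> bool" where
  "exp3p_run M f \<alpha> \<gamma> T r i \<longleftrightarrow>
     prob_space M \<and>
     prob_space.indep_vars M (\<lambda>_. borel) r {1..T} \<and>
     (\<forall>t\<in>{1..T}. distributed M lborel (r t) (\<lambda>x. ennreal (f x))) \<and>
     (\<forall>t\<in>{1..T}. i t \<in> M \<rightarrow>\<^sub>M count_space UNIV) \<and>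
     (\<forall>t\<in>{1..T}. \<forall>j. AE \<omega> in M.
        real_cond_exp M (draw_info M T r i t) (indicator {\<omega> \<in> space M. i t \<omega> = j}) \<omega>
          = exp3p_prob \<alpha> \<gamma> T (\<lambda>s. r s \<omega>) (\<lambda>s. i s \<omega>) t j)"

text \<open>\<open>h = O\<^sup>*(g)\<close>: domination as \<open>T \<rightarrow> \<infinity>\<close> up to a power of \<open>log g\<close>.\<close>

definition bigostar :: "(nat \<Rightarrow> real) \<Rightarrow> (nat \<Rightarrow> real) set" where
  "bigostar g = {h. \<exists>k::int. h \<in> O(\<lambda>T. g T * ln (g T) powi k)}"

end

theory Submission
  imports Defs "HOL-Real_Asymp.Real_Asymp"
begin

text \<open>
  Since \<open>h\<close> may depend on \<open>f\<close> and \<open>\<delta>\<close>, an expected regret of order \<open>sqrt T\<close> up to a logarithm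
  together with Markov's inequality suffices, and no truncation of the rewards is needed.

  Let \<open>W(t)\<close> be the total weight and \<open>\<eta> = \<gamma> / (3K)\<close>. Because \<open>\<eta> / p\<^sub>j(t) \<le> 1/3\<close>, the weight
  increments are controlled by \<open>exp z \<le> 1 + z + z\<^sup>2 exp \<bar>z\<bar>\<close>, with a quadratic error involving only
  \<open>V(x) = x\<^sup>2 exp (\<bar>x\<bar> / 3)\<close>, whose mean is finite for sub-Gaussian \<open>x\<close>. Taking
  expectations in the usual bounds on \<open>ln W(T) - ln W(0)\<close>, the importance weights cancel and give
  \<open>T max\<^sub>j \<mu>\<^sub>j - E (\<Sum>\<^sub>t y\<^sub>t) = O(sqrt T log T)\<close>. The bonus is nonnegative, hence harmless in the lower
  bound, and of total order \<open>\<eta> \<alpha> sqrt T\<close> in the upper bound.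

  The left-hand side is the mean of the nonnegative pseudo-regret \<open>\<Sum>\<^sub>t (max\<^sub>j \<mu>\<^sub>j - \<mu> (i\<^sub>t))\<close>. The regret
  exceeds it by at most the absolute values of \<open>\<Sum>\<^sub>t (y\<^sub>t - \<mu> (i\<^sub>t))\<close> and \<open>\<Sum>\<^sub>t (r\<^sup>t\<^sub>j - \<mu>\<^sub>j)\<close>, sums of orthogonal
  terms with second moment \<open>O(T)\<close>.
\<close>

section \<open>The potential along a sample path\<close>

lemma exp_le_quadratic:
  fixes z c :: real
  assumes "\<bar>z\<bar> \<le> c"
  shows "exp z \<le> 1 + z + z\<^sup>2 * exp c"
proof -
  obtain t where t: "\<bar>t\<bar> \<le> \<bar>z\<bar>" "exp z = (\<Sum>m<2. z ^ m / fact m) + exp t / fact 2 * z ^ 2"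
    using Maclaurin_exp_le[of z 2] by blast
  have "exp t * z\<^sup>2 \<le> exp c * z\<^sup>2"
    using t(1) assms by (intro mult_right_mono) auto
  moreover have "0 \<le> exp t * z\<^sup>2" by simp
  ultimately have "exp t * z\<^sup>2 / 2 \<le> exp c * z\<^sup>2" by linarith
  with t(2) show ?thesis
    by (simp add: lessThan_nat_numeral eval_nat_numeral(2) mult.commute numeral_2_eq_2)
qed

lemma exp_minus_one_le:
  fixes b B :: real
  assumes "0 \<le> b" "b \<le> B"
  shows "exp b - 1 \<le> b * exp B"
proof -
  have "(1 - b) * exp b \<le> exp (- b) * exp b"
    using exp_ge_add_one_self[of "- b"] by (intro mult_right_mono) auto
  then have "exp b - 1 \<le> b * exp b"
    by (simp add: exp_minus algebra_simps)
  also have "\<dots> \<le> b * exp B"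
    using assms by (intro mult_left_mono) auto
  finally show ?thesis .
qed

text \<open>With \<open>u = 2/3 * \<bar>y\<bar>\<close>, the quadratic Taylor term
  \<open>u\<^sup>2 / 2\<close> of \<open>exp u\<close> equals \<open>2/9 * y\<^sup>2\<close>; this
  is the source of \<open>9/2\<close>, and the exponents \<open>2/3\<close> and \<open>1/3\<close>
  add up to 1. It makes the quadratic error integrable.\<close>

lemma square_times_exp_le:
  fixes y :: real
  shows "y\<^sup>2 * exp (\<bar>y\<bar> / 3) \<le> 9 / 2 * exp \<bar>y\<bar>"
proof -
  have "1 + 2/3 * \<bar>y\<bar> + (2/3 * \<bar>y\<bar>)\<^sup>2 / 2 \<le> exp (2/3 * \<bar>y\<bar>)"
    by (rule exp_lower_Taylor_quadratic) simp
  then have "y\<^sup>2 \<le> 9 / 2 * exp (2/3 * \<bar>y\<bar>)"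
    by (simp add: power2_eq_square)
  then have "y\<^sup>2 * exp (\<bar>y\<bar> / 3) \<le> 9 / 2 * exp (2/3 * \<bar>y\<bar>) * exp (\<bar>y\<bar> / 3)"
    by (intro mult_right_mono) auto
  also have "\<dots> = 9 / 2 * exp \<bar>y\<bar>"
    by (simp add: mult.assoc flip: exp_add)
  finally show ?thesis .
qed

section \<open>Bounds on weights and probabilities, and their dependence on the past\<close>

lemma exp3p_weight_pos: "0 < exp3p_weight \<alpha> \<gamma> T r i n j"
  by (induction n arbitrary: j) (simp_all add: Let_def)

lemma exp3p_weight_sum_pos: "0 < (\<Sum>l\<in>UNIV. exp3p_weight \<alpha> \<gamma> T r i n l)"
  by (intro sum_pos) (auto simp: exp3p_weight_pos)

lemma exp3p_prob_ge:
  assumes "\<gamma> \<le> 1"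
  shows "\<gamma> / real CARD('k) \<le> exp3p_prob \<alpha> \<gamma> T r i t (j :: 'k::finite)"
  using assms
  by (simp add: exp3p_prob_def exp3p_mix_def less_imp_le exp3p_weight_pos exp3p_weight_sum_pos)

lemma exp3p_prob_pos:
  assumes "0 < \<gamma>" "\<gamma> \<le> 1"
  shows "0 < exp3p_prob \<alpha> \<gamma> T r i t (j :: 'k::finite)"
  by (rule less_le_trans[OF _ exp3p_prob_ge]) (use assms in auto)

lemma exp3p_prob_le_1:
  assumes "0 \<le> \<gamma>" "\<gamma> \<le> 1"
  shows "exp3p_prob \<alpha> \<gamma> T r i t (j :: 'k::finite) \<le> 1"
proof -
  let ?w = "exp3p_weight \<alpha> \<gamma> T r i (t - 1)"
  have "?w j \<le> (\<Sum>l\<in>UNIV. ?w l)"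
    by (rule member_le_sum) (auto simp: exp3p_weight_pos less_imp_le)
  then have "?w j / (\<Sum>l\<in>UNIV. ?w l) \<le> 1"
    using exp3p_weight_sum_pos[of \<alpha> \<gamma> T r i "t - 1"] by simp
  then have "(1 - \<gamma>) * (?w j / (\<Sum>l\<in>UNIV. ?w l)) \<le> 1 - \<gamma>"
    using assms by (intro mult_left_le) auto
  moreover have "\<gamma> / real CARD('k) \<le> \<gamma>"
    using assms(1) by (simp add: divide_le_eq mult_le_cancel_left1 Suc_le_eq)
  ultimately show ?thesis
    by (simp add: exp3p_prob_def exp3p_mix_def)
qed

lemma exp3p_weight_cong:
  assumes "\<And>s. s \<in> {1..n} \<Longrightarrow> r s = r' s" "\<And>s. s \<in> {1..n} \<Longrightarrow> i s = i' s"
  shows "exp3p_weight \<alpha> \<gamma> T r i n = exp3p_weight \<alpha> \<gamma> T r' i' n"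
  using assms by (induction n) (simp_all add: Let_def)

text \<open>Allows \<open>p(t)\<close> to be evaluated along a fixed sequence of arms and on rewards
  restricted to earlier rounds, as in \<open>expectation_path\<close>.\<close>

lemma exp3p_prob_cong:
  assumes "\<And>s. s \<in> {1..<t} \<Longrightarrow> r s = r' s" "\<And>s. s \<in> {1..<t} \<Longrightarrow> i s = i' s"
  shows "exp3p_prob \<alpha> \<gamma> T r i t = exp3p_prob \<alpha> \<gamma> T r' i' t"
  unfolding exp3p_prob_def
  by (intro arg_cong[where f = "exp3p_mix \<gamma>"] exp3p_weight_cong assms) auto

section \<open>Measurability of weights and probabilities\<close>

lemma borel_measurable_vec_nth [measurable]:
  "(\<lambda>x :: real ^ 'k. x $ j) \<in> borel_measurable borel"
  by (intro borel_measurable_continuous_onI continuous_intros)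

lemma measurable_exp3p_weight:
  assumes "\<And>s. s \<in> {1..n} \<Longrightarrow> (\<lambda>\<omega>. r \<omega> s) \<in> N \<rightarrow>\<^sub>M borel"
    and "\<And>s. s \<in> {1..n} \<Longrightarrow> (\<lambda>\<omega>. i \<omega> s) \<in> N \<rightarrow>\<^sub>M count_space UNIV"
  shows "(\<lambda>\<omega>. exp3p_weight \<alpha> \<gamma> T (r \<omega>) (i \<omega>) n j) \<in> borel_measurable N"
  using assms
proof (induction n arbitrary: j)
  case (Suc n)
  have [measurable]: "(\<lambda>\<omega>. exp3p_weight \<alpha> \<gamma> T (r \<omega>) (i \<omega>) n j) \<in> borel_measurable N" for j
    by (rule Suc.IH) (use Suc.prems in auto)
  have [measurable]: "(\<lambda>\<omega>. r \<omega> (Suc n)) \<in> N \<rightarrow>\<^sub>M borel"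
      "(\<lambda>\<omega>. i \<omega> (Suc n)) \<in> N \<rightarrow>\<^sub>M count_space UNIV"
    using Suc.prems by auto
  have [measurable]: "(\<lambda>\<omega>. of_bool (j = i \<omega> (Suc n)) :: real) \<in> borel_measurable N"
    unfolding of_bool_def by measurable
  show ?case
    unfolding exp3p_weight.simps Let_def exp3p_mix_def by measurable
qed simp

text \<open>The space \<open>N\<close> is left general: the result serves for the sigma-algebra
  \<open>draw_info\<close> and, with constant arms, for the product space of reward
  sequences.\<close>

lemma measurable_exp3p_prob:
  assumes "\<And>s. s \<in> {1..<t} \<Longrightarrow> (\<lambda>\<omega>. r \<omega> s) \<in> N \<rightarrow>\<^sub>M borel"
    and "\<And>s. s \<in> {1..<t} \<Longrightarrow> (\<lambda>\<omega>. i \<omega> s) \<in> N \<rightarrow>\<^sub>M count_space UNIV"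
  shows "(\<lambda>\<omega>. exp3p_prob \<alpha> \<gamma> T (r \<omega>) (i \<omega>) t j) \<in> borel_measurable N"
proof -
  have [measurable]: "(\<lambda>\<omega>. exp3p_weight \<alpha> \<gamma> T (r \<omega>) (i \<omega>) (t - 1) j) \<in> borel_measurable N" for j
    by (rule measurable_exp3p_weight) (use assms in auto)
  show ?thesis
    unfolding exp3p_prob_def exp3p_mix_def by measurable
qed

section \<open>Growth of a single weight and of the total weight\<close>

lemma exp3p_weight_increment_le:
  fixes y :: real
  assumes p: "0 < p" and \<eta>: "0 < \<eta>" "\<eta> / p \<le> 1 / 3" and b: "0 \<le> b" "b \<le> B"
  shows "exp (\<eta> * (y / p * of_bool c) + b) - 1 \<le>
    exp B * b * exp (\<bar>y\<bar> / 3) + \<eta> * (y / p * of_bool c) +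
    \<eta>\<^sup>2 * (y\<^sup>2 * exp (\<bar>y\<bar> / 3) / p\<^sup>2 * of_bool c)"
proof -
  define z where "z = \<eta> * (y / p * of_bool c)"
  have "\<bar>z\<bar> \<le> \<bar>y\<bar> * (\<eta> / p)"
    using p \<eta> by (auto simp: z_def abs_mult of_bool_def field_simps)
  also have "\<dots> \<le> \<bar>y\<bar> * (1 / 3)"
    using \<eta> by (intro mult_left_mono) auto
  finally have z: "\<bar>z\<bar> \<le> \<bar>y\<bar> / 3" by simp
  \<comment> \<open>This separates the bonus \<open>b\<close>, estimated linearly, from the reward
    part \<open>z\<close>, which may have either sign and gets the quadratic bound. Both
    exponentials of \<open>z\<close> are then controlled by \<open>\<bar>y\<bar> / 3\<close>, free
    of \<open>p\<close>.\<close>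
  have "exp (z + b) - 1 = (exp b - 1) * exp z + (exp z - 1)"
    by (simp add: exp_add algebra_simps)
  also have "(exp b - 1) * exp z \<le> (b * exp B) * exp (\<bar>y\<bar> / 3)"
    using exp_minus_one_le[OF b] z b by (intro mult_mono) auto
  also have "exp z - 1 \<le> z + z\<^sup>2 * exp (\<bar>y\<bar> / 3)"
    using exp_le_quadratic[OF z] by simp
  also have "z\<^sup>2 * exp (\<bar>y\<bar> / 3) = \<eta>\<^sup>2 * (y\<^sup>2 * exp (\<bar>y\<bar> / 3) / p\<^sup>2 * of_bool c)"
    by (simp add: z_def power_mult_distrib power_divide of_bool_def)
  finally show ?thesis
    unfolding z_def[symmetric] by (simp only: mult.commute[of b] add.assoc)
qed

text \<open>The logarithm of the multiplicative update is additive over rounds, and each exploration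
  bonus, being nonnegative, is dropped.\<close>

lemma exp3p_log_weight_ge:
  fixes r :: "nat \<Rightarrow> real ^ 'k" and j :: "'k::finite"
  assumes "0 < \<gamma>" "\<gamma> < 1" "0 \<le> \<alpha>"
  shows "\<gamma> / (3 * real CARD('k)) *
      (\<Sum>t=1..n. r t $ j / exp3p_prob \<alpha> \<gamma> T r i t j * of_bool (j = i t)) +
      ln (exp3p_weight \<alpha> \<gamma> T r i 0 j) \<le> ln (exp3p_weight \<alpha> \<gamma> T r i n j)"
proof (induction n)
  case (Suc n)
  let ?p = "exp3p_prob \<alpha> \<gamma> T r i (Suc n) j"
  have p: "0 < ?p" using assms by (intro exp3p_prob_pos) auto
  have "ln (exp3p_weight \<alpha> \<gamma> T r i (Suc n) j) =
    ln (exp3p_weight \<alpha> \<gamma> T r i n j) + \<gamma> / (3 * real CARD('k)) *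
      (r (Suc n) $ j / ?p * of_bool (j = i (Suc n)) + \<alpha> / (?p * sqrt (real CARD('k) * real T)))"
    using exp3p_weight_pos[of \<alpha> \<gamma> T r i n j]
    by (simp add: Let_def ln_mult exp3p_prob_def)
  moreover have "0 \<le> \<gamma> / (3 * real CARD('k)) * (\<alpha> / (?p * sqrt (real CARD('k) * real T)))"
    using p assms by simp
  ultimately show ?case
    using Suc by (simp add: algebra_simps del: exp3p_weight.simps)
qed simp

text \<open>
  The factor \<open>1 - \<gamma>\<close> turns the normalised weight into at most \<open>p\<close>, which cancels the \<open>1 / p\<close>
  in the exploration bonus and one of the two factors \<open>1 / p\<close> in the quadratic term.
\<close>

lemma exp3p_log_potential_step:
  fixes r :: "nat \<Rightarrow> real ^ 'k" and i :: "nat \<Rightarrow> 'k::finite"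
  assumes \<gamma>: "0 < \<gamma>" "\<gamma> < 1" and \<alpha>: "0 \<le> \<alpha>" and T: "1 \<le> T"
    and B: "\<alpha> / (3 * sqrt (real CARD('k) * real T)) \<le> B"
  defines "\<eta> \<equiv> \<gamma> / (3 * real CARD('k))"
    and "W \<equiv> \<lambda>n. \<Sum>l\<in>UNIV. exp3p_weight \<alpha> \<gamma> T r i n l"
    and "p \<equiv> exp3p_prob \<alpha> \<gamma> T r i"
  shows "(1 - \<gamma>) * (ln (W (Suc n)) - ln (W n)) \<le>
    (\<Sum>j\<in>UNIV. exp B * (\<eta> * \<alpha> / sqrt (real CARD('k) * real T)) * exp (\<bar>r (Suc n) $ j\<bar> / 3))
    + \<eta> * r (Suc n) $ i (Suc n)
    - \<eta> * \<gamma> / real CARD('k) *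
        (\<Sum>j\<in>UNIV. r (Suc n) $ j / p (Suc n) j * of_bool (j = i (Suc n)))
    + \<eta>\<^sup>2 * (\<Sum>j\<in>UNIV. (r (Suc n) $ j)\<^sup>2 * exp (\<bar>r (Suc n) $ j\<bar> / 3) / p (Suc n) j *
        of_bool (j = i (Suc n)))"
proof -
  define q where "q = p (Suc n)"
  define y where "y = (\<lambda>j. r (Suc n) $ j)"
  define c where "c = (\<lambda>j. j = i (Suc n))"
  define R where "R = sqrt (real CARD('k) * real T)"
  define u where "u = (\<lambda>j. exp3p_weight \<alpha> \<gamma> T r i n j / W n)"
  define U where "U = (\<lambda>j. exp (\<bar>y j\<bar> / 3))"
  have K: "0 < real CARD('k)" by simp
  have R: "0 < R" using T by (simp add: R_def)
  have \<eta>: "0 < \<eta>" using \<gamma> by (simp add: \<eta>_def)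
  have W: "0 < W m" for m unfolding W_def by (rule exp3p_weight_sum_pos)
  have q_pos: "0 < q j" for j unfolding q_def p_def using \<gamma> by (intro exp3p_prob_pos) auto
  have q_ge: "\<gamma> / real CARD('k) \<le> q j" for j
    unfolding q_def p_def using \<gamma> by (intro exp3p_prob_ge) auto
  \<comment> \<open>Forced exploration gives \<open>q j \<ge> \<gamma> / K\<close>, and
    \<open>\<eta> = \<gamma> / (3K)\<close>; the factor 3 in the learning rate yields
    \<open>1/3\<close> here.\<close>
  have \<eta>q: "\<eta> / q j \<le> 1 / 3" for j
    using q_ge[of j] q_pos[of j] K by (simp add: \<eta>_def field_simps)
  have qu: "q j = (1 - \<gamma>) * u j + \<gamma> / real CARD('k)" for j
    by (simp add: q_def p_def exp3p_prob_def exp3p_mix_def u_def W_def)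
  have u: "0 \<le> u j" for j
    using W[of n] exp3p_weight_pos[of \<alpha> \<gamma> T r i n j] by (simp add: u_def)
  have sum_u: "(\<Sum>j\<in>UNIV. u j) = 1"
    using W[of n] by (simp add: u_def flip: sum_divide_distrib) (simp add: W_def)
  define b where "b = (\<lambda>j. \<eta> * (\<alpha> / (q j * R)))"
  have b: "0 \<le> b j" "b j \<le> B" for j
  proof -
    show "0 \<le> b j" using \<eta> \<alpha> q_pos[of j] R by (simp add: b_def)
    have "b j = (\<eta> / q j) * (\<alpha> / R)" by (simp add: b_def)
    also have "\<dots> \<le> (1 / 3) * (\<alpha> / R)" using \<alpha> R by (intro mult_right_mono \<eta>q) simp
    also have "\<dots> \<le> B" using B by (simp add: R_def)
    finally show "b j \<le> B" .
  qed
  define e where "e = (\<lambda>j. exp (\<eta> * (y j / q j * of_bool (c j)) + b j) - 1)"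
  have w: "exp3p_weight \<alpha> \<gamma> T r i (Suc n) j = exp3p_weight \<alpha> \<gamma> T r i n j * (1 + e j)" for j
    by (simp add: Let_def e_def y_def c_def b_def q_def p_def exp3p_prob_def \<eta>_def R_def
        distrib_left)
  have "W (Suc n) = (\<Sum>j\<in>UNIV. exp3p_weight \<alpha> \<gamma> T r i n j * (1 + e j))"
    unfolding W_def by (intro sum.cong w refl)
  then have "W (Suc n) / W n = (\<Sum>j\<in>UNIV. u j * (1 + e j))"
    by (simp add: u_def sum_divide_distrib)
  also have "\<dots> = 1 + (\<Sum>j\<in>UNIV. u j * e j)"
    by (simp add: distrib_left sum.distrib sum_u)
  finally have WW: "W (Suc n) / W n = 1 + (\<Sum>j\<in>UNIV. u j * e j)" .
  have "ln (W (Suc n)) - ln (W n) = ln (W (Suc n) / W n)"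
    using W[of n] W[of "Suc n"] by (simp add: ln_div)
  also have "\<dots> \<le> W (Suc n) / W n - 1"
    by (intro ln_le_minus_one divide_pos_pos W)
  also have "\<dots> = (\<Sum>j\<in>UNIV. u j * e j)" by (simp add: WW)
  finally have "(1 - \<gamma>) * (ln (W (Suc n)) - ln (W n)) \<le> (1 - \<gamma>) * (\<Sum>j\<in>UNIV. u j * e j)"
    using \<gamma> by (intro mult_left_mono) auto
  also have "\<dots> = (\<Sum>j\<in>UNIV. (1 - \<gamma>) * u j * e j)"
    by (simp add: sum_distrib_left mult.assoc)
  also have "\<dots> \<le> (\<Sum>j\<in>UNIV. exp B * (\<eta> * \<alpha> / R) * U j + \<eta> * (y j * of_bool (c j))
      - \<eta> * \<gamma> / real CARD('k) * (y j / q j * of_bool (c j))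
      + \<eta>\<^sup>2 * ((y j)\<^sup>2 * U j / q j * of_bool (c j)))"
  proof (rule sum_mono)
    fix j
    have uq: "0 \<le> (1 - \<gamma>) * u j" "(1 - \<gamma>) * u j \<le> q j"
      using \<gamma> u[of j] qu[of j] by auto
    have "(1 - \<gamma>) * u j * e j \<le> (1 - \<gamma>) * u j * (exp B * b j * U j +
        \<eta> * (y j / q j * of_bool (c j)) + \<eta>\<^sup>2 * ((y j)\<^sup>2 * U j / (q j)\<^sup>2 * of_bool (c j)))"
      unfolding e_def U_def
      by (intro mult_left_mono exp3p_weight_increment_le q_pos \<eta> \<eta>q b uq)
    also have "\<dots> = (1 - \<gamma>) * u j * (exp B * b j * U j) +
        (1 - \<gamma>) * u j * (\<eta> * (y j / q j * of_bool (c j))) +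
        (1 - \<gamma>) * u j * (\<eta>\<^sup>2 * ((y j)\<^sup>2 * U j / (q j)\<^sup>2 * of_bool (c j)))"
      by (simp add: distrib_left)
    also have "(1 - \<gamma>) * u j * (exp B * b j * U j) \<le> q j * (exp B * b j * U j)"
      using uq b[of j] by (intro mult_right_mono) (auto simp: U_def)
    also have "q j * (exp B * b j * U j) = exp B * (\<eta> * \<alpha> / R) * U j"
      using q_pos[of j] by (simp add: b_def)
    also have "(1 - \<gamma>) * u j * (\<eta>\<^sup>2 * ((y j)\<^sup>2 * U j / (q j)\<^sup>2 * of_bool (c j))) \<le>
        q j * (\<eta>\<^sup>2 * ((y j)\<^sup>2 * U j / (q j)\<^sup>2 * of_bool (c j)))"
      using uq by (intro mult_right_mono) (auto simp: U_def)
    also have "q j * (\<eta>\<^sup>2 * ((y j)\<^sup>2 * U j / (q j)\<^sup>2 * of_bool (c j))) =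
        \<eta>\<^sup>2 * ((y j)\<^sup>2 * U j / q j * of_bool (c j))"
      using q_pos[of j] by (simp add: power2_eq_square)
    \<comment> \<open>The linear term needs an identity, not an estimate by \<open>q j\<close>,
      because the reward \<open>y j\<close> may be negative. The difference
      \<open>\<gamma> / K\<close> between \<open>q j\<close> and \<open>(1 - \<gamma>) * u j\<close>
      is the source of the subtracted sum.\<close>
    also have "(1 - \<gamma>) * u j * (\<eta> * (y j / q j * of_bool (c j))) =
        \<eta> * (y j * of_bool (c j)) - \<eta> * \<gamma> / real CARD('k) * (y j / q j * of_bool (c j))"
    proof -
      have "(1 - \<gamma>) * u j = q j - \<gamma> / real CARD('k)" using qu[of j] by simp
      moreover have "(q j - \<gamma> / real CARD('k)) * (\<eta> * (y j / q j)) =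
          \<eta> * y j - \<eta> * \<gamma> / real CARD('k) * (y j / q j)"
        using q_pos[of j] K by (simp add: field_simps)
      ultimately show ?thesis
        by (cases "c j") simp_all
    qed
    finally show "(1 - \<gamma>) * u j * e j \<le> exp B * (\<eta> * \<alpha> / R) * U j + \<eta> * (y j * of_bool (c j))
      - \<eta> * \<gamma> / real CARD('k) * (y j / q j * of_bool (c j))
      + \<eta>\<^sup>2 * ((y j)\<^sup>2 * U j / q j * of_bool (c j))"
      by simp
  qed
  also have "\<dots> = (\<Sum>j\<in>UNIV. exp B * (\<eta> * \<alpha> / R) * U j) + \<eta> * (\<Sum>j\<in>UNIV. y j * of_bool (c j))
      - \<eta> * \<gamma> / real CARD('k) * (\<Sum>j\<in>UNIV. y j / q j * of_bool (c j))
      + \<eta>\<^sup>2 * (\<Sum>j\<in>UNIV. (y j)\<^sup>2 * U j / q j * of_bool (c j))"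
    by (simp only: sum.distrib sum_subtractf sum_distrib_left)
  also have "(\<Sum>j\<in>UNIV. y j * of_bool (c j)) = r (Suc n) $ i (Suc n)"
    by (simp add: c_def y_def)
  finally show ?thesis
    unfolding y_def c_def q_def R_def U_def .
qed

text \<open>The increase of the log potential lies between the gain of a single arm
  \<open>l\<close>, whose weight is at most the total, and the telescoped one-round
  estimates.\<close>

lemma exp3p_log_potential:
  fixes r :: "nat \<Rightarrow> real ^ 'k" and i :: "nat \<Rightarrow> 'k::finite"
  assumes \<gamma>: "0 < \<gamma>" "\<gamma> < 1" and \<alpha>: "0 \<le> \<alpha>" and T: "1 \<le> T"
    and B: "\<alpha> / (3 * sqrt (real CARD('k) * real T)) \<le> B"
  defines "\<eta> \<equiv> \<gamma> / (3 * real CARD('k))"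
    and "p \<equiv> exp3p_prob \<alpha> \<gamma> T r i"
  shows "(1 - \<gamma>) * (\<eta> * (\<Sum>t=1..T. r t $ l / p t l * of_bool (l = i t)) - ln (real CARD('k))) \<le>
    (\<Sum>t=1..T. \<Sum>j\<in>UNIV. exp B * (\<eta> * \<alpha> / sqrt (real CARD('k) * real T)) * exp (\<bar>r t $ j\<bar> / 3))
    + \<eta> * (\<Sum>t=1..T. r t $ i t)
    - \<eta> * \<gamma> / real CARD('k) * (\<Sum>t=1..T. \<Sum>j\<in>UNIV. r t $ j / p t j * of_bool (j = i t))
    + \<eta>\<^sup>2 * (\<Sum>t=1..T. \<Sum>j\<in>UNIV. (r t $ j)\<^sup>2 * exp (\<bar>r t $ j\<bar> / 3) / p t j * of_bool (j = i t))"
proof -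
  define W where "W = (\<lambda>n. \<Sum>l\<in>UNIV. exp3p_weight \<alpha> \<gamma> T r i n l)"
  have W: "0 < W m" for m unfolding W_def by (rule exp3p_weight_sum_pos)
  have upper: "(1 - \<gamma>) * (ln (W n) - ln (W 0)) \<le>
    (\<Sum>t=1..n. \<Sum>j\<in>UNIV. exp B * (\<eta> * \<alpha> / sqrt (real CARD('k) * real T)) * exp (\<bar>r t $ j\<bar> / 3))
    + \<eta> * (\<Sum>t=1..n. r t $ i t)
    - \<eta> * \<gamma> / real CARD('k) * (\<Sum>t=1..n. \<Sum>j\<in>UNIV. r t $ j / p t j * of_bool (j = i t))
    + \<eta>\<^sup>2 * (\<Sum>t=1..n. \<Sum>j\<in>UNIV. (r t $ j)\<^sup>2 * exp (\<bar>r t $ j\<bar> / 3) / p t j * of_bool (j = i t))"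
    for n
  proof (induction n)
    case (Suc n)
    have S: "sum F {1..Suc n} = sum F {1..n} + F (Suc n)" for F :: "nat \<Rightarrow> real" by simp
    have "(1 - \<gamma>) * (ln (W (Suc n)) - ln (W 0)) =
        (1 - \<gamma>) * (ln (W (Suc n)) - ln (W n)) + (1 - \<gamma>) * (ln (W n) - ln (W 0))"
      by (simp add: algebra_simps)
    then show ?case
      using Suc exp3p_log_potential_step[OF \<gamma> \<alpha> T B, of r i n, folded \<eta>_def p_def]
      unfolding W_def S distrib_left by linarith
  qed simp
  have "\<eta> * (\<Sum>t=1..T. r t $ l / p t l * of_bool (l = i t)) + ln (exp3p_weight \<alpha> \<gamma> T r i 0 l)
      \<le> ln (exp3p_weight \<alpha> \<gamma> T r i T l)"
    unfolding \<eta>_def p_def by (rule exp3p_log_weight_ge[OF \<gamma> \<alpha>])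
  also have "\<dots> \<le> ln (W T)"
    using member_le_sum[of l UNIV "exp3p_weight \<alpha> \<gamma> T r i T"]
    by (simp add: W_def exp3p_weight_pos less_imp_le exp3p_weight_sum_pos)
  \<comment> \<open>All initial weights are equal, so \<open>W 0\<close> is \<open>K\<close> times
    any one of them.\<close>
  also have "ln (exp3p_weight \<alpha> \<gamma> T r i 0 l) = ln (W 0) - ln (real CARD('k))"
    by (simp add: W_def ln_mult)
  finally have "\<eta> * (\<Sum>t=1..T. r t $ l / p t l * of_bool (l = i t)) - ln (real CARD('k))
      \<le> ln (W T) - ln (W 0)" by simp
  then have "(1 - \<gamma>) * (\<eta> * (\<Sum>t=1..T. r t $ l / p t l * of_bool (l = i t)) - ln (real CARD('k)))
      \<le> (1 - \<gamma>) * (ln (W T) - ln (W 0))"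
    using \<gamma> by (intro mult_left_mono) auto
  with upper[of T] show ?thesis by linarith
qed

section \<open>Exponential moments of sub-Gaussian variables\<close>

text \<open>Slicing by integer levels: \<open>exp \<bar>X\<bar>\<close> is at most 1 plus the sum of
  \<open>exp (n + 1)\<close> over all \<open>n\<close> with \<open>\<bar>X\<bar> > n\<close>, and
  the Gaussian tails bound the integrated series by a geometric one.\<close>

lemma subgaussian_integrable_exp_abs:
  assumes "prob_space M" and sub: "subgaussian M X \<sigma>" and \<sigma>: "\<sigma> > 0"
  shows "integrable M (\<lambda>\<omega>. exp \<bar>X \<omega>\<bar>)"
proof -
  interpret prob_space M by fact
  have [measurable]: "X \<in> borel_measurable M" using sub by (simp add: subgaussian_def)
  obtain B where B: "B > 0" "\<And>s. s > 0 \<Longrightarrow> prob {\<omega> \<in> space M. \<bar>X \<omega>\<bar> > s} \<le> B * exp (- \<sigma>\<^sup>2 * s\<^sup>2)"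
    using sub by (auto simp: subgaussian_def)
  define A where "A = (\<lambda>n::nat. {\<omega> \<in> space M. \<bar>X \<omega>\<bar> > real n})"
  define c where "c = max 1 B * exp (1 + 1 / \<sigma>\<^sup>2)"
  have A [measurable]: "A n \<in> sets M" for n unfolding A_def by measurable
  \<comment> \<open>The tail hypothesis covers \<open>s > 0\<close>; at \<open>n = 0\<close> the
    trivial bound 1 is used, whence \<open>max 1 B\<close>.\<close>
  have prob_A: "prob (A n) \<le> max 1 B * exp (- \<sigma>\<^sup>2 * (real n)\<^sup>2)" for n
  proof (cases "n = 0")
    case False
    then have "prob (A n) \<le> B * exp (- \<sigma>\<^sup>2 * (real n)\<^sup>2)"
      using B(2)[of "real n"] by (simp add: A_def)
    also have "\<dots> \<le> max 1 B * exp (- \<sigma>\<^sup>2 * (real n)\<^sup>2)" by (intro mult_right_mono) auto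
    finally show ?thesis .
  qed (simp add: le_max_iff_disj)
  have weighted: "exp (real n + 1) * prob (A n) \<le> c * exp (- 1) ^ n" for n
  proof -
    \<comment> \<open>Completing the square trades the Gaussian exponent for a linear one of slope
      2; against the weight \<open>exp (n + 1)\<close> a decay \<open>exp (- n)\<close>
      remains.\<close>
    have "0 \<le> (\<sigma> * real n - 1 / \<sigma>)\<^sup>2" by simp
    then have "2 * real n - 1 / \<sigma>\<^sup>2 \<le> \<sigma>\<^sup>2 * (real n)\<^sup>2"
      using \<sigma> by (simp add: power2_diff power_mult_distrib power_divide)
    then have *: "real n + 1 + - \<sigma>\<^sup>2 * (real n)\<^sup>2 \<le> 1 + 1 / \<sigma>\<^sup>2 + real n * - 1" by simp
    have "exp (real n + 1) * prob (A n) \<le> exp (real n + 1) * (max 1 B * exp (- \<sigma>\<^sup>2 * (real n)\<^sup>2))"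
      by (intro mult_left_mono prob_A) simp
    also have "\<dots> = max 1 B * exp (real n + 1 + - \<sigma>\<^sup>2 * (real n)\<^sup>2)"
      by (simp only: exp_add ac_simps)
    also have "\<dots> \<le> max 1 B * exp (1 + 1 / \<sigma>\<^sup>2 + real n * - 1)"
      using * by (intro mult_left_mono) auto
    also have "\<dots> = c * exp (- 1) ^ n"
      by (simp only: c_def exp_add exp_of_nat_mult)
    finally show ?thesis .
  qed
  have "exp (- 1 :: real) < 1" by simp
  then have summable: "summable (\<lambda>n. c * exp (- 1 :: real) ^ n)"
    by (intro summable_mult summable_geometric) simp
  have finite: "(\<Sum>n. ennreal (c * exp (- 1) ^ n)) \<noteq> \<top>"
    by (rule ennreal_suminf_neq_top[OF summable]) (simp add: c_def)
  have single: "F n \<le> suminf F" for F :: "nat \<Rightarrow> ennreal" and n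
    using sum_le_suminf[of F "{n}"] by simp
  have pointwise: "ennreal (exp \<bar>X \<omega>\<bar>) \<le> 1 + (\<Sum>n. ennreal (exp (real n + 1)) * indicator (A n) \<omega>)"
    if "\<omega> \<in> space M" for \<omega>
  proof (cases "X \<omega> = 0")
    case False
    \<comment> \<open>This choice gives \<open>n < \<bar>X \<omega>\<bar> \<le> n + 1\<close>, with
      the strict inequality demanded by \<open>A n\<close>. At \<open>X \<omega> = 0\<close> no such
      \<open>n\<close> exists and the summand 1 takes over.\<close>
    define n where "n = nat (\<lceil>\<bar>X \<omega>\<bar>\<rceil> - 1)"
    have n: "real n < \<bar>X \<omega>\<bar>" "\<bar>X \<omega>\<bar> \<le> real n + 1"
      using False unfolding n_def by linarith+
    have "ennreal (exp \<bar>X \<omega>\<bar>) \<le> ennreal (exp (real n + 1)) * indicator (A n) \<omega>"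
      using n that by (simp add: A_def ennreal_leI)
    also have "\<dots> \<le> (\<Sum>n. ennreal (exp (real n + 1)) * indicator (A n) \<omega>)"
      by (rule single)
    also have "\<dots> \<le> 1 + \<dots>" by simp
    finally show ?thesis .
  qed simp
  have "(\<integral>\<^sup>+\<omega>. ennreal (exp \<bar>X \<omega>\<bar>) \<partial>M) \<le>
      (\<integral>\<^sup>+\<omega>. 1 + (\<Sum>n. ennreal (exp (real n + 1)) * indicator (A n) \<omega>) \<partial>M)"
    by (intro nn_integral_mono pointwise)
  also have "\<dots> = 1 + (\<Sum>n. ennreal (exp (real n + 1)) * emeasure M (A n))"
    by (simp add: nn_integral_add nn_integral_suminf nn_integral_cmult_indicator emeasure_space_1)
  also have "\<dots> \<le> 1 + (\<Sum>n. ennreal (c * exp (- 1) ^ n))"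
    using weighted by (intro add_left_mono suminf_le)
      (auto simp: emeasure_eq_measure ennreal_mult[symmetric] intro!: ennreal_leI)
  also have "\<dots> < \<infinity>"
    using finite by (simp add: less_top[symmetric])
  finally show ?thesis
    by (intro integrableI_bounded) auto
qed

section \<open>Conditional draws and orthogonality of the noise\<close>

lemma (in prob_space) integral_square_orthogonal_sum:
  fixes X :: "nat \<Rightarrow> 'a \<Rightarrow> real"
  assumes "finite I"
    and int: "\<And>s t. s \<in> I \<Longrightarrow> t \<in> I \<Longrightarrow> integrable M (\<lambda>\<omega>. X s \<omega> * X t \<omega>)"
    and orth: "\<And>s t. s \<in> I \<Longrightarrow> t \<in> I \<Longrightarrow> s < t \<Longrightarrow> (\<integral>\<omega>. X s \<omega> * X t \<omega> \<partial>M) = 0"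
  shows "integrable M (\<lambda>\<omega>. (\<Sum>t\<in>I. X t \<omega>)\<^sup>2)"
    and "(\<integral>\<omega>. (\<Sum>t\<in>I. X t \<omega>)\<^sup>2 \<partial>M) = (\<Sum>t\<in>I. \<integral>\<omega>. (X t \<omega>)\<^sup>2 \<partial>M)"
proof -
  have eq: "(\<Sum>t\<in>I. X t \<omega>)\<^sup>2 = (\<Sum>s\<in>I. \<Sum>t\<in>I. X s \<omega> * X t \<omega>)" for \<omega>
    by (simp add: power2_eq_square sum_product)
  show "integrable M (\<lambda>\<omega>. (\<Sum>t\<in>I. X t \<omega>)\<^sup>2)"
    unfolding eq by (intro Bochner_Integration.integrable_sum int)
  have orth': "(\<integral>\<omega>. X s \<omega> * X t \<omega> \<partial>M) = (if s = t then \<integral>\<omega>. (X t \<omega>)\<^sup>2 \<partial>M else 0)"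
    if "s \<in> I" "t \<in> I" for s t
    using orth[OF that] orth[OF that(2,1)]
    by (cases s t rule: linorder_cases) (simp_all add: mult.commute power2_eq_square)
  have "(\<integral>\<omega>. (\<Sum>t\<in>I. X t \<omega>)\<^sup>2 \<partial>M) = (\<Sum>s\<in>I. \<Sum>t\<in>I. \<integral>\<omega>. X s \<omega> * X t \<omega> \<partial>M)"
    unfolding eq by (simp add: Bochner_Integration.integral_sum Bochner_Integration.integrable_sum int)
  also have "\<dots> = (\<Sum>s\<in>I. \<Sum>t\<in>I. if s = t then \<integral>\<omega>. (X t \<omega>)\<^sup>2 \<partial>M else 0)"
    by (intro sum.cong refl orth')
  also have "\<dots> = (\<Sum>t\<in>I. \<integral>\<omega>. (X t \<omega>)\<^sup>2 \<partial>M)"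
    using assms(1) by simp
  finally show "(\<integral>\<omega>. (\<Sum>t\<in>I. X t \<omega>)\<^sup>2 \<partial>M) = (\<Sum>t\<in>I. \<integral>\<omega>. (X t \<omega>)\<^sup>2 \<partial>M)" .
qed

text \<open>The tails of the rewards enter in the form of \<open>exp_moment\<close>, which dominates
  every moment used below.\<close>

locale exp3p_process =
  fixes M :: "'w measure" and f :: "real ^ 'k \<Rightarrow> real" and \<alpha> \<gamma> :: real and T :: nat
    and r :: "nat \<Rightarrow> 'w \<Rightarrow> real ^ 'k" and i :: "nat \<Rightarrow> 'w \<Rightarrow> 'k::finite"
  assumes run: "exp3p_run M f \<alpha> \<gamma> T r i"
    and \<gamma>: "0 < \<gamma>" "\<gamma> < 1"
    and exp_moment: "\<And>j. integrable (density lborel (\<lambda>x. ennreal (f x))) (\<lambda>x. exp \<bar>x $ j\<bar>)"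
begin

sublocale prob_space M
  using run by (simp add: exp3p_run_def)

abbreviation D :: "(real ^ 'k) measure" where
  "D \<equiv> density lborel (\<lambda>x. ennreal (f x))"

abbreviation p :: "nat \<Rightarrow> 'k \<Rightarrow> 'w \<Rightarrow> real" where
  "p t j \<omega> \<equiv> exp3p_prob \<alpha> \<gamma> T (\<lambda>s. r s \<omega>) (\<lambda>s. i s \<omega>) t j"

section \<open>Histories, conditional draws and importance weights\<close>

lemma measurable_r: "t \<in> {1..T} \<Longrightarrow> r t \<in> M \<rightarrow>\<^sub>M borel"
  using run by (auto simp: exp3p_run_def distributed_def)

lemma measurable_i: "t \<in> {1..T} \<Longrightarrow> i t \<in> M \<rightarrow>\<^sub>M count_space UNIV"
  using run by (auto simp: exp3p_run_def)

lemma distr_r: "t \<in> {1..T} \<Longrightarrow> distr M borel (r t) = D"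
  using run distributed_distr_eq_density[of M lborel "r t"]
  by (auto simp: exp3p_run_def cong: distr_cong)

lemma
  fixes g :: "real ^ 'k \<Rightarrow> real"
  assumes "t \<in> {1..T}" and [measurable]: "g \<in> borel_measurable borel"
  shows integrable_reward_iff: "integrable M (\<lambda>\<omega>. g (r t \<omega>)) \<longleftrightarrow> integrable D g"
    and expectation_reward: "(\<integral>\<omega>. g (r t \<omega>) \<partial>M) = (\<integral>x. g x \<partial>D)"
  unfolding distr_r[OF assms(1), symmetric]
  using measurable_r[OF assms(1)] by (simp_all add: integrable_distr_eq integral_distr)

lemma measurable_draw_map:
  assumes "t \<le> T"
  shows "(\<lambda>\<omega>. (\<lambda>s\<in>{1..T}. r s \<omega>, \<lambda>s\<in>{1..<t}. i s \<omega>)) \<in>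
    M \<rightarrow>\<^sub>M (\<Pi>\<^sub>M s\<in>{1..T}. borel) \<Otimes>\<^sub>M (\<Pi>\<^sub>M s\<in>{1..<t}. count_space UNIV)"
  using assms by (intro measurable_Pair measurable_restrict measurable_r measurable_i) auto

lemma space_draw_info: "space (draw_info M T r i t) = space M"
  by (simp add: draw_info_def)

lemma subalgebra_draw_info:
  assumes "t \<le> T"
  shows "subalgebra M (draw_info M T r i t)"
proof -
  have "sets (draw_info M T r i t) \<subseteq> sets M"
    unfolding draw_info_def sets_vimage_algebra
    by (rule sets.sigma_sets_subset) (use measurable_sets[OF measurable_draw_map[OF assms]] in blast)
  then show ?thesis
    by (simp add: subalgebra_def space_draw_info)
qed

lemma measurable_draw_info_pair:
  "(\<lambda>\<omega>. (\<lambda>s\<in>{1..T}. r s \<omega>, \<lambda>s\<in>{1..<t}. i s \<omega>)) \<in>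
    draw_info M T r i t \<rightarrow>\<^sub>M (\<Pi>\<^sub>M s\<in>{1..T}. borel) \<Otimes>\<^sub>M (\<Pi>\<^sub>M s\<in>{1..<t}. count_space UNIV)"
  unfolding draw_info_def
  by (rule measurable_vimage_algebra1) (auto simp: space_pair_measure space_PiM)

lemma measurable_r_draw_info:
  assumes "s \<in> {1..T}"
  shows "r s \<in> draw_info M T r i t \<rightarrow>\<^sub>M borel"
proof -
  have "(\<lambda>x. fst x s) \<circ> (\<lambda>\<omega>. (\<lambda>s\<in>{1..T}. r s \<omega>, \<lambda>s\<in>{1..<t}. i s \<omega>)) \<in> draw_info M T r i t \<rightarrow>\<^sub>M borel"
    by (rule measurable_comp[OF measurable_draw_info_pair])
       (intro measurable_compose[OF measurable_fst] measurable_component_singleton assms)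
  then show ?thesis
    using assms by (simp add: comp_def)
qed

lemma measurable_i_draw_info:
  assumes "s \<in> {1..<t}"
  shows "i s \<in> draw_info M T r i t \<rightarrow>\<^sub>M count_space UNIV"
proof -
  have "(\<lambda>x. snd x s) \<circ> (\<lambda>\<omega>. (\<lambda>s\<in>{1..T}. r s \<omega>, \<lambda>s\<in>{1..<t}. i s \<omega>)) \<in>
      draw_info M T r i t \<rightarrow>\<^sub>M count_space UNIV"
    by (rule measurable_comp[OF measurable_draw_info_pair])
       (intro measurable_compose[OF measurable_snd] measurable_component_singleton assms)
  then show ?thesis
    using assms by (simp add: comp_def)
qed

lemma measurable_p_draw_info:
  assumes "t \<le> T"
  shows "p t j \<in> borel_measurable (draw_info M T r i t)"
  using assms by (intro measurable_exp3p_prob measurable_r_draw_info measurable_i_draw_info) auto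

lemma measurable_p:
  assumes "t \<le> T"
  shows "p t j \<in> borel_measurable M"
  by (rule measurable_from_subalg[OF subalgebra_draw_info measurable_p_draw_info]) (fact assms)+

lemma p_bounds: "0 < p t j \<omega>" "\<gamma> / real CARD('k) \<le> p t j \<omega>" "p t j \<omega> \<le> 1"
  using \<gamma> by (auto intro: exp3p_prob_pos exp3p_prob_ge exp3p_prob_le_1)

lemma integrable_mult_draw:
  fixes G :: "'w \<Rightarrow> real"
  assumes "t \<in> {1..T}" "integrable M G"
  shows "integrable M (\<lambda>\<omega>. G \<omega> * of_bool (j = i t \<omega>))"
proof (rule Bochner_Integration.integrable_bound[OF assms(2)])
  have [measurable]: "G \<in> borel_measurable M" "i t \<in> M \<rightarrow>\<^sub>M count_space UNIV"
    using assms measurable_i by auto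
  show "(\<lambda>\<omega>. G \<omega> * of_bool (j = i t \<omega>)) \<in> borel_measurable M"
    unfolding of_bool_def by measurable
qed auto

text \<open>The sampling rule of the player enters here: for \<open>G\<close> known before the draw,
  conditioning acts only on the indicator of the drawn arm and turns it into \<open>p t j\<close>
  almost everywhere.\<close>

lemma expectation_draw:
  fixes G :: "'w \<Rightarrow> real"
  assumes t: "t \<in> {1..T}" and G: "integrable M G" "G \<in> borel_measurable (draw_info M T r i t)"
  shows "(\<integral>\<omega>. G \<omega> * of_bool (j = i t \<omega>) \<partial>M) = (\<integral>\<omega>. G \<omega> * p t j \<omega> \<partial>M)"
proof -
  let ?F = "draw_info M T r i t"
  let ?A = "{\<omega> \<in> space M. i t \<omega> = j}"
  have sub: "subalgebra M ?F" using t by (intro subalgebra_draw_info) auto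
  interpret finite_measure_subalgebra M ?F
    by unfold_locales (fact sub)
  have [measurable]: "G \<in> borel_measurable M" "i t \<in> M \<rightarrow>\<^sub>M count_space UNIV"
    using G t measurable_i by auto
  have A: "?A \<in> sets M" by measurable
  have eq: "G \<omega> * of_bool (j = i t \<omega>) = G \<omega> * indicator ?A \<omega>" if "\<omega> \<in> space M" for \<omega>
    using that by (auto simp: indicator_def)
  have int: "integrable M (\<lambda>\<omega>. G \<omega> * indicator ?A \<omega>)"
    using integrable_mult_draw[OF t G(1), of j]
    by (rule Bochner_Integration.integrable_cong[THEN iffD1, rotated -1]) (simp_all add: eq)
  have "(\<integral>\<omega>. G \<omega> * of_bool (j = i t \<omega>) \<partial>M) = (\<integral>\<omega>. G \<omega> * indicator ?A \<omega> \<partial>M)"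
    by (intro Bochner_Integration.integral_cong refl eq)
  also have "\<dots> = (\<integral>\<omega>. G \<omega> * real_cond_exp M ?F (indicator ?A) \<omega> \<partial>M)"
    using A by (intro real_cond_exp_intg(2)[symmetric] int G) simp
  also have "\<dots> = (\<integral>\<omega>. G \<omega> * p t j \<omega> \<partial>M)"
  proof (rule integral_cong_AE)
    have "AE \<omega> in M. real_cond_exp M ?F (indicator ?A) \<omega> = p t j \<omega>"
      using run t by (simp add: exp3p_run_def)
    then show "AE \<omega> in M. G \<omega> * real_cond_exp M ?F (indicator ?A) \<omega> = G \<omega> * p t j \<omega>"
      by eventually_elim simp
    have [measurable]: "p t j \<in> borel_measurable M" using t by (intro measurable_p) auto
    show "(\<lambda>\<omega>. G \<omega> * p t j \<omega>) \<in> borel_measurable M" by measurable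
  qed measurable
  finally show ?thesis .
qed

text \<open>Before the draw of round \<open>t\<close>, \<open>draw_info\<close> already contains the
  reward of that round, so \<open>g (r t) / p t j\<close> is an admissible factor in
  \<open>expectation_draw\<close>, and the probabilities cancel. Integrability comes from
  \<open>1 / p t j \<le> K / \<gamma>\<close>.\<close>

lemma
  fixes g :: "real ^ 'k \<Rightarrow> real"
  assumes t: "t \<in> {1..T}" and g [measurable]: "g \<in> borel_measurable borel" and int: "integrable D g"
  shows expectation_importance_weighted:
      "(\<integral>\<omega>. g (r t \<omega>) / p t j \<omega> * of_bool (j = i t \<omega>) \<partial>M) = (\<integral>x. g x \<partial>D)"
    and integrable_importance_weighted:
      "integrable M (\<lambda>\<omega>. g (r t \<omega>) / p t j \<omega> * of_bool (j = i t \<omega>))"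
proof -
  have [measurable]: "p t j \<in> borel_measurable (draw_info M T r i t)"
      "r t \<in> draw_info M T r i t \<rightarrow>\<^sub>M borel"
    using t by (auto intro: measurable_p_draw_info measurable_r_draw_info)
  have meas: "(\<lambda>\<omega>. g (r t \<omega>) / p t j \<omega>) \<in> borel_measurable (draw_info M T r i t)"
    by measurable
  have "integrable M (\<lambda>\<omega>. g (r t \<omega>))"
    using int by (simp add: integrable_reward_iff[OF t g])
  then have int': "integrable M (\<lambda>\<omega>. g (r t \<omega>) / p t j \<omega>)"
  proof (rule Bochner_Integration.integrable_bound[OF integrable_mult_right[of "real CARD('k) / \<gamma>"]])
    show "(\<lambda>\<omega>. g (r t \<omega>) / p t j \<omega>) \<in> borel_measurable M"
      using t by (intro measurable_from_subalg[OF subalgebra_draw_info meas]) auto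
    show "AE \<omega> in M. norm (g (r t \<omega>) / p t j \<omega>) \<le> norm (real CARD('k) / \<gamma> * g (r t \<omega>))"
    proof (rule AE_I2)
      fix \<omega>
      have "1 / p t j \<omega> \<le> real CARD('k) / \<gamma>"
        using p_bounds[of \<omega> t j] \<gamma> by (simp add: field_simps)
      then have "\<bar>g (r t \<omega>)\<bar> * (1 / p t j \<omega>) \<le> \<bar>g (r t \<omega>)\<bar> * (real CARD('k) / \<gamma>)"
        by (intro mult_left_mono) auto
      then show "norm (g (r t \<omega>) / p t j \<omega>) \<le> norm (real CARD('k) / \<gamma> * g (r t \<omega>))"
        using p_bounds(1)[of \<omega> t j] \<gamma> by (simp add: abs_mult mult.commute)
    qed
  qed
  show "integrable M (\<lambda>\<omega>. g (r t \<omega>) / p t j \<omega> * of_bool (j = i t \<omega>))"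
    by (rule integrable_mult_draw[OF t int'])
  have "(\<integral>\<omega>. g (r t \<omega>) / p t j \<omega> * of_bool (j = i t \<omega>) \<partial>M) = (\<integral>\<omega>. g (r t \<omega>) / p t j \<omega> * p t j \<omega> \<partial>M)"
    by (rule expectation_draw[OF t int' meas])
  also have "\<dots> = (\<integral>\<omega>. g (r t \<omega>) \<partial>M)"
    using p_bounds(1)[of _ t j] by (intro Bochner_Integration.integral_cong refl) (simp add: less_imp_neq[symmetric])
  also have "\<dots> = (\<integral>x. g x \<partial>D)"
    by (rule expectation_reward[OF t g])
  finally show "(\<integral>\<omega>. g (r t \<omega>) / p t j \<omega> * of_bool (j = i t \<omega>) \<partial>M) = (\<integral>x. g x \<partial>D)" .
qed

text \<open>Along a fixed path \<open>k\<close> the indicators of the arms are removed from the last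
  round backwards, each replaced by a probability that depends on earlier rewards only and is
  absorbed into \<open>u\<close>. Once none is left, independence of round \<open>t\<close> from the
  earlier rounds factorises the expectation, and the factor of \<open>v\<close> vanishes. The case
  \<open>n = t\<close> is included because \<open>p(t)\<close> ignores the reward of round
  \<open>t\<close>.\<close>

lemma expectation_path:
  fixes v :: "real ^ 'k \<Rightarrow> real" and u :: "(nat \<Rightarrow> real ^ 'k) \<Rightarrow> real" and k :: "nat \<Rightarrow> 'k"
  assumes t: "t \<in> {1..T}" and v: "v \<in> borel_measurable borel" "integrable D v" "(\<integral>x. v x \<partial>D) = 0"
    and u: "u \<in> borel_measurable (\<Pi>\<^sub>M s\<in>{1..<t}. borel)"
      "integrable M (\<lambda>\<omega>. u (\<lambda>s\<in>{1..<t}. r s \<omega>))"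
    and n: "n \<le> t"
  shows "integrable M (\<lambda>\<omega>. u (\<lambda>s\<in>{1..<t}. r s \<omega>) * v (r t \<omega>) * of_bool (\<forall>s\<in>{1..n}. k s = i s \<omega>)) \<and>
    (\<integral>\<omega>. u (\<lambda>s\<in>{1..<t}. r s \<omega>) * v (r t \<omega>) * of_bool (\<forall>s\<in>{1..n}. k s = i s \<omega>) \<partial>M) = 0"
  using u n
proof (induction n arbitrary: u)
  case (0 u)
  have "indep_var (\<Pi>\<^sub>M s\<in>{1..<t}. borel) (\<lambda>\<omega>. \<lambda>s\<in>{1..<t}. r s \<omega>)
      (\<Pi>\<^sub>M s\<in>{t}. borel) (\<lambda>\<omega>. \<lambda>s\<in>{t}. r s \<omega>)"
    using run t by (intro indep_var_restrict[where I = "{1..T}"]) (auto simp: exp3p_run_def)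
  then have "indep_var borel (u \<circ> (\<lambda>\<omega>. \<lambda>s\<in>{1..<t}. r s \<omega>))
      borel ((\<lambda>x. v (x t)) \<circ> (\<lambda>\<omega>. \<lambda>s\<in>{t}. r s \<omega>))"
    by (rule indep_var_compose)
       (use 0 v in \<open>auto intro: measurable_compose[OF measurable_component_singleton]\<close>)
  then have ind: "indep_var borel (\<lambda>\<omega>. u (\<lambda>s\<in>{1..<t}. r s \<omega>)) borel (\<lambda>\<omega>. v (r t \<omega>))"
    by (simp add: comp_def)
  have int: "integrable M (\<lambda>\<omega>. v (r t \<omega>))"
    using v by (simp add: integrable_reward_iff[OF t v(1)])
  show ?case
    using indep_var_lebesgue_integral[OF ind 0(2) int] indep_var_integrable[OF ind 0(2) int]
    by (simp add: expectation_reward[OF t v(1)] v(3))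
next
  case (Suc n u)
  let ?R = "\<lambda>\<omega>. \<lambda>s\<in>{1..<t}. r s \<omega>"
  \<comment> \<open>The absorbed probability is positive and at most 1, so integrability survives;
    it looks at rounds up to \<open>n\<close> only, all of them before \<open>t\<close>.\<close>
  define u' where "u' = (\<lambda>x. u x * exp3p_prob \<alpha> \<gamma> T x k (Suc n) (k (Suc n)))"
  have nT: "Suc n \<in> {1..T}" using Suc.prems t by auto
  have [measurable]: "(\<lambda>x. exp3p_prob \<alpha> \<gamma> T x k (Suc n) (k (Suc n))) \<in> borel_measurable (\<Pi>\<^sub>M s\<in>{1..<t}. borel)"
    using Suc.prems by (intro measurable_exp3p_prob measurable_component_singleton) auto
  have u'_meas: "u' \<in> borel_measurable (\<Pi>\<^sub>M s\<in>{1..<t}. borel)"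
    unfolding u'_def using Suc.prems(1) by measurable
  have R: "?R \<in> M \<rightarrow>\<^sub>M (\<Pi>\<^sub>M s\<in>{1..<t}. borel)"
    using t by (intro measurable_restrict measurable_r) auto
  have u'_int: "integrable M (\<lambda>\<omega>. u' (?R \<omega>))"
  proof (rule Bochner_Integration.integrable_bound[OF Suc.prems(2)])
    show "(\<lambda>\<omega>. u' (?R \<omega>)) \<in> borel_measurable M"
      by (rule measurable_compose[OF R u'_meas])
    show "AE \<omega> in M. norm (u' (?R \<omega>)) \<le> norm (u (?R \<omega>))"
    proof (rule AE_I2)
      fix \<omega>
      have "\<bar>exp3p_prob \<alpha> \<gamma> T (?R \<omega>) k (Suc n) (k (Suc n))\<bar> \<le> 1"
        using \<gamma> by (simp add: exp3p_prob_le_1 exp3p_prob_pos less_imp_le abs_of_nonneg)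
      then show "norm (u' (?R \<omega>)) \<le> norm (u (?R \<omega>))"
        by (simp add: u'_def abs_mult mult_left_le)
    qed
  qed
  let ?G = "\<lambda>\<omega>. u (?R \<omega>) * v (r t \<omega>) * of_bool (\<forall>s\<in>{1..n}. k s = i s \<omega>)"
  have IH: "integrable M ?G" by (rule conjunct1[OF Suc.IH[OF Suc.prems(1,2) Suc_leD[OF Suc.prems(3)]]])
  have split: "u (?R \<omega>) * v (r t \<omega>) * of_bool (\<forall>s\<in>{1..Suc n}. k s = i s \<omega>) =
      ?G \<omega> * of_bool (k (Suc n) = i (Suc n) \<omega>)" for \<omega>
    by (auto simp: atLeastAtMostSuc_conv)
  \<comment> \<open>\<open>?G\<close> contains the reward of round \<open>t\<close>, possibly later
    than \<open>Suc n\<close>; it is measurable because \<open>draw_info\<close> records the rewards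
    of the whole horizon.\<close>
  have G_meas: "?G \<in> borel_measurable (draw_info M T r i (Suc n))"
  proof -
    have [measurable]: "i s \<in> draw_info M T r i (Suc n) \<rightarrow>\<^sub>M count_space UNIV" if "s \<in> {1..n}" for s
      using that by (intro measurable_i_draw_info) auto
    have [measurable]: "(\<lambda>\<omega>. u (?R \<omega>)) \<in> borel_measurable (draw_info M T r i (Suc n))"
      using t by (intro measurable_compose[OF _ Suc.prems(1)] measurable_restrict measurable_r_draw_info) auto
    have [measurable]: "(\<lambda>\<omega>. v (r t \<omega>)) \<in> borel_measurable (draw_info M T r i (Suc n))"
      using t by (intro measurable_compose[OF _ v(1)] measurable_r_draw_info) auto
    show ?thesis unfolding of_bool_def by measurable
  qed
  have "(\<integral>\<omega>. ?G \<omega> * of_bool (k (Suc n) = i (Suc n) \<omega>) \<partial>M) = (\<integral>\<omega>. ?G \<omega> * p (Suc n) (k (Suc n)) \<omega> \<partial>M)"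
    by (rule expectation_draw[OF nT IH G_meas])
  also have "\<dots> = (\<integral>\<omega>. u' (?R \<omega>) * v (r t \<omega>) * of_bool (\<forall>s\<in>{1..n}. k s = i s \<omega>) \<partial>M)"
  proof (intro Bochner_Integration.integral_cong refl)
    fix \<omega>
    show "?G \<omega> * p (Suc n) (k (Suc n)) \<omega> = u' (?R \<omega>) * v (r t \<omega>) * of_bool (\<forall>s\<in>{1..n}. k s = i s \<omega>)"
    proof (cases "\<forall>s\<in>{1..n}. k s = i s \<omega>")
      \<comment> \<open>On this event the actual arms agree with \<open>k\<close> before round
        \<open>Suc n\<close>; off it both sides are 0.\<close>
      case True
      have "exp3p_prob \<alpha> \<gamma> T (\<lambda>s. r s \<omega>) (\<lambda>s. i s \<omega>) (Suc n) = exp3p_prob \<alpha> \<gamma> T (?R \<omega>) k (Suc n)"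
        using True Suc.prems(3) by (intro exp3p_prob_cong) auto
      then show ?thesis by (simp add: u'_def)
    qed auto
  qed
  also have "\<dots> = 0"
    by (rule conjunct2[OF Suc.IH[OF u'_meas u'_int Suc_leD[OF Suc.prems(3)]]])
  finally show ?case
    unfolding split using integrable_mult_draw[OF nT IH] by blast
qed

text \<open>
  Summing over the finitely many possible sequences of arms up to round \<open>t\<close> turns the history of
  the player into a function of the earlier rewards only, which are independent of round \<open>t\<close>.
\<close>

lemma expectation_history_mult_centred:
  fixes u :: "(nat \<Rightarrow> 'k) \<Rightarrow> (nat \<Rightarrow> real ^ 'k) \<Rightarrow> real" and v :: "'k \<Rightarrow> real ^ 'k \<Rightarrow> real"
  assumes t: "t \<in> {1..T}"
    and v: "\<And>j. v j \<in> borel_measurable borel" "\<And>j. integrable D (v j)" "\<And>j. (\<integral>x. v j x \<partial>D) = 0"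
    and u: "\<And>k. u k \<in> borel_measurable (\<Pi>\<^sub>M s\<in>{1..<t}. borel)"
      "\<And>k. integrable M (\<lambda>\<omega>. u k (\<lambda>s\<in>{1..<t}. r s \<omega>))"
      "\<forall>k k'. (\<forall>s\<in>{1..t}. k s = k' s) \<longrightarrow> u k = u k'"
  shows "integrable M (\<lambda>\<omega>. u (\<lambda>s. i s \<omega>) (\<lambda>s\<in>{1..<t}. r s \<omega>) * v (i t \<omega>) (r t \<omega>))"
    and "(\<integral>\<omega>. u (\<lambda>s. i s \<omega>) (\<lambda>s\<in>{1..<t}. r s \<omega>) * v (i t \<omega>) (r t \<omega>) \<partial>M) = 0"
proof -
  let ?R = "\<lambda>\<omega>. \<lambda>s\<in>{1..<t}. r s \<omega>"
  let ?P = "PiE {1..t} (\<lambda>_. UNIV :: 'k set)"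
  have fin: "finite ?P" by (intro finite_PiE) auto
  have eq: "u (\<lambda>s. i s \<omega>) (?R \<omega>) * v (i t \<omega>) (r t \<omega>) =
      (\<Sum>k\<in>?P. u k (?R \<omega>) * v (k t) (r t \<omega>) * of_bool (\<forall>s\<in>{1..t}. k s = i s \<omega>))" for \<omega>
  proof -
    \<comment> \<open>The path actually taken, cut to an element of \<open>?P\<close>; since the
      functions in \<open>?P\<close> are extensional, it is the only one with a nonzero
      indicator.\<close>
    define h where "h = (\<lambda>s\<in>{1..t}. i s \<omega>)"
    have h: "h \<in> ?P" "h t = i t \<omega>" using t by (auto simp: h_def)
    have "(\<forall>s\<in>{1..t}. k s = i s \<omega>) \<longleftrightarrow> k = h" if "k \<in> ?P" for k
      using that by (auto simp: h_def PiE_def extensional_def fun_eq_iff)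
    then have "(\<Sum>k\<in>?P. u k (?R \<omega>) * v (k t) (r t \<omega>) * of_bool (\<forall>s\<in>{1..t}. k s = i s \<omega>)) =
        (\<Sum>k\<in>?P. if k = h then u h (?R \<omega>) * v (h t) (r t \<omega>) else 0)"
      by (intro sum.cong refl) (simp only: of_bool_def mult_1_right mult_zero_right split: if_split, blast)
    also have "\<dots> = u h (?R \<omega>) * v (h t) (r t \<omega>)"
      using fin h(1) by (simp only: sum.delta if_True)
    also have "u h = u (\<lambda>s. i s \<omega>)" by (rule u(3)[rule_format]) (simp add: h_def)
    finally show ?thesis unfolding h(2) by (rule sym)
  qed
  note path = expectation_path[OF t v u(1,2) order_refl]
  show "integrable M (\<lambda>\<omega>. u (\<lambda>s. i s \<omega>) (?R \<omega>) * v (i t \<omega>) (r t \<omega>))"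
    unfolding eq using path by (intro Bochner_Integration.integrable_sum) blast
  show "(\<integral>\<omega>. u (\<lambda>s. i s \<omega>) (?R \<omega>) * v (i t \<omega>) (r t \<omega>) \<partial>M) = 0"
    unfolding eq
    by (subst Bochner_Integration.integral_sum) (use path in \<open>blast, intro sum.neutral ballI, blast\<close>)
qed

end

section \<open>Moments of the rewards and of the noise\<close>

context exp3p_process
begin

abbreviation m :: "'k \<Rightarrow> real" where
  "m j \<equiv> (\<integral>x. x $ j \<partial>D)"

abbreviation S :: "'k \<Rightarrow> real" where
  "S j \<equiv> (\<integral>x. (x $ j - m j)\<^sup>2 \<partial>D)"

abbreviation U :: "'k \<Rightarrow> real ^ 'k \<Rightarrow> real" where
  "U j x \<equiv> exp (\<bar>x $ j\<bar> / 3)"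

abbreviation V :: "'k \<Rightarrow> real ^ 'k \<Rightarrow> real" where
  "V j x \<equiv> (x $ j)\<^sup>2 * exp (\<bar>x $ j\<bar> / 3)"

text \<open>Centring at the mean of the pulled arm, rather than at the mixture of means under
  \<open>p(t)\<close>, keeps the conditional mean zero even when the arm of round \<open>t\<close>
  is known, and leaves the pseudo-regret as remainder.\<close>

abbreviation noise :: "nat \<Rightarrow> 'w \<Rightarrow> real" where
  "noise t \<omega> \<equiv> r t \<omega> $ i t \<omega> - m (i t \<omega>)"

lemma integrable_le_exp:
  fixes g :: "real ^ 'k \<Rightarrow> real"
  assumes "g \<in> borel_measurable borel" "\<And>x. \<bar>g x\<bar> \<le> c * exp \<bar>x $ j\<bar>"
  shows "integrable D g"
proof (rule Bochner_Integration.integrable_bound[OF integrable_mult_right[OF exp_moment]])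
  show "AE x in D. norm (g x) \<le> norm (c * exp \<bar>x $ j\<bar>)"
    by (rule AE_I2) (use assms(2) in \<open>auto intro: order_trans[OF _ abs_ge_self]\<close>)
qed (use assms(1) in simp)

lemma integrable_U: "integrable D (U j)"
  by (rule integrable_le_exp[of _ 1 j]) auto

lemma integrable_V: "integrable D (V j)"
  by (rule integrable_le_exp[of _ "9 / 2" j]) (use square_times_exp_le in auto)

lemma integrable_D_const: "integrable D (\<lambda>x. c :: real)"
proof (rule integrable_le_exp[of _ "\<bar>c\<bar>"])
  show "\<bar>c\<bar> \<le> \<bar>c\<bar> * exp \<bar>x $ j\<bar>" for x and j :: 'k
    by (simp add: mult_le_cancel_left1)
qed simp

lemma integrable_coordinate: "integrable D (\<lambda>x. x $ j)"
proof (rule integrable_le_exp[of _ 1 j])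
  show "\<bar>x $ j\<bar> \<le> 1 * exp \<bar>x $ j\<bar>" for x :: "real ^ 'k"
    using exp_ge_add_one_self[of "\<bar>x $ j\<bar>"] by linarith
qed simp

lemma integrable_centred: "integrable D (\<lambda>x. x $ j - m j)"
  by (intro Bochner_Integration.integrable_diff integrable_coordinate integrable_D_const)

lemma integrable_centred_square: "integrable D (\<lambda>x. (x $ j - m j)\<^sup>2)"
proof -
  have "integrable D (\<lambda>x. (x $ j)\<^sup>2)"
  proof (rule integrable_le_exp[of _ "9 / 2" j])
    have "(x $ j)\<^sup>2 \<le> (x $ j)\<^sup>2 * exp (\<bar>x $ j\<bar> / 3)" for x :: "real ^ 'k"
      by (simp add: mult_le_cancel_left1)
    then show "\<bar>(x $ j)\<^sup>2\<bar> \<le> 9 / 2 * exp \<bar>x $ j\<bar>" for x :: "real ^ 'k"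
      unfolding abs_power2 by (rule order_trans) (rule square_times_exp_le)
  qed simp
  then show ?thesis
    unfolding power2_diff
    by (intro Bochner_Integration.integrable_add Bochner_Integration.integrable_diff
        integrable_D_const integrable_mult_left integrable_mult_right integrable_coordinate)
qed

lemma prob_space_D:
  assumes "1 \<le> T"
  shows "prob_space D"
  using prob_space_distr[OF measurable_r[of 1]] assms distr_r[of 1] by simp

lemma integral_centred:
  assumes "1 \<le> T"
  shows "(\<integral>x. x $ j - m j \<partial>D) = 0"
proof -
  interpret D: prob_space D by (rule prob_space_D[OF assms])
  show ?thesis
    using D.prob_space
    by (simp add: Bochner_Integration.integral_diff[OF integrable_coordinate integrable_D_const])
qed

lemma sum_of_drawn:
  fixes g :: "'k \<Rightarrow> real"
  shows "g (i t \<omega>) = (\<Sum>j\<in>UNIV. g j * of_bool (j = i t \<omega>))"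
  by simp

lemma integrable_drawn:
  fixes g :: "'k \<Rightarrow> 'w \<Rightarrow> real"
  assumes "t \<in> {1..T}" "\<And>j. integrable M (g j)"
  shows "integrable M (\<lambda>\<omega>. g (i t \<omega>) \<omega>)"
proof -
  have "g (i t \<omega>) \<omega> = (\<Sum>j\<in>UNIV. g j \<omega> * of_bool (j = i t \<omega>))" for \<omega>
    by (rule sum_of_drawn)
  then show ?thesis
    by (simp only: integrable_mult_draw[OF assms] Bochner_Integration.integrable_sum)
qed

lemma integrable_reward_centred_square:
  assumes "t \<in> {1..T}"
  shows "integrable M (\<lambda>\<omega>. (r t \<omega> $ j - m j)\<^sup>2)"
  using integrable_centred_square by (subst integrable_reward_iff[OF assms]) auto

text \<open>Bounding the square at the drawn arm by the sum over all arms removes the random index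
  and with it the law of the draw.\<close>

lemma noise_square:
  assumes t: "t \<in> {1..T}"
  shows "integrable M (\<lambda>\<omega>. (noise t \<omega>)\<^sup>2)" "(\<integral>\<omega>. (noise t \<omega>)\<^sup>2 \<partial>M) \<le> (\<Sum>j\<in>UNIV. S j)"
proof -
  show int: "integrable M (\<lambda>\<omega>. (noise t \<omega>)\<^sup>2)"
    by (rule integrable_drawn[OF t integrable_reward_centred_square[OF t]])
  have "(\<integral>\<omega>. (noise t \<omega>)\<^sup>2 \<partial>M) \<le> (\<integral>\<omega>. (\<Sum>j\<in>UNIV. (r t \<omega> $ j - m j)\<^sup>2) \<partial>M)"
    by (intro integral_mono int Bochner_Integration.integrable_sum integrable_reward_centred_square t)
       (rule member_le_sum, auto)
  also have "\<dots> = (\<Sum>j\<in>UNIV. \<integral>\<omega>. (r t \<omega> $ j - m j)\<^sup>2 \<partial>M)"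
    by (intro Bochner_Integration.integral_sum integrable_reward_centred_square t)
  also have "\<dots> = (\<Sum>j\<in>UNIV. S j)"
    by (intro sum.cong refl expectation_reward t) measurable
  finally show "(\<integral>\<omega>. (noise t \<omega>)\<^sup>2 \<partial>M) \<le> (\<Sum>j\<in>UNIV. S j)" .
qed

lemma noise_mean_zero:
  assumes t: "t \<in> {1..T}"
  shows "integrable M (noise t)" "(\<integral>\<omega>. noise t \<omega> \<partial>M) = 0"
proof -
  have T: "1 \<le> T" using t by auto
  have v: "(\<lambda>x. x $ j - m j) \<in> borel_measurable borel" for j by measurable
  have u: "(\<lambda>_. 1) \<in> borel_measurable (\<Pi>\<^sub>M s\<in>{1..<t}. borel)" "integrable M (\<lambda>_. 1 :: real)"
    by simp_all
  note * = expectation_history_mult_centred[where u = "\<lambda>_ _. 1" and v = "\<lambda>j x. x $ j - m j",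
      OF t v integrable_centred integral_centred[OF T] u]
  show "integrable M (noise t)" using *(1) by simp
  show "(\<integral>\<omega>. noise t \<omega> \<partial>M) = 0" using *(2) by simp
qed

lemma noise_orthogonal:
  assumes s: "s \<in> {1..T}" and t: "t \<in> {1..T}" and st: "s < t"
  shows "integrable M (\<lambda>\<omega>. noise s \<omega> * noise t \<omega>)" "(\<integral>\<omega>. noise s \<omega> * noise t \<omega> \<partial>M) = 0"
proof -
  have T: "1 \<le> T" using t by auto
  \<comment> \<open>The earlier noise, read as a function of the arm path and of the rewards before
    round \<open>t\<close>: the history factor for the centred reward of round
    \<open>t\<close>.\<close>
  define u where "u = (\<lambda>k (x :: nat \<Rightarrow> real ^ 'k). x s $ k s - m (k s))"
  have s': "s \<in> {1..<t}" using s st by auto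
  have u: "u k \<in> borel_measurable (\<Pi>\<^sub>M s\<in>{1..<t}. borel)" for k
    unfolding u_def by (intro borel_measurable_diff borel_measurable_const
        measurable_compose[OF measurable_component_singleton[OF s'] borel_measurable_vec_nth])
  have int: "integrable M (\<lambda>\<omega>. u k (\<lambda>s\<in>{1..<t}. r s \<omega>))" for k
    using s' integrable_reward_iff[OF s, of "\<lambda>x. x $ k s - m (k s)"] integrable_centred[of "k s"]
    by (simp add: u_def)
  have cong: "\<forall>k k'. (\<forall>s\<in>{1..t}. k s = k' s) \<longrightarrow> u k = u k'"
    using s st by (simp add: u_def)
  have v: "(\<lambda>x. x $ j - m j) \<in> borel_measurable borel" for j by measurable
  note * = expectation_history_mult_centred[where v = "\<lambda>j x. x $ j - m j",
      OF t v integrable_centred integral_centred[OF T] u int cong]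
  show "integrable M (\<lambda>\<omega>. noise s \<omega> * noise t \<omega>)" "(\<integral>\<omega>. noise s \<omega> * noise t \<omega> \<partial>M) = 0"
    using *[unfolded u_def] s' by simp_all
qed

lemma noise_second_moment:
  shows "integrable M (\<lambda>\<omega>. (\<Sum>t=1..T. noise t \<omega>)\<^sup>2)"
    and "(\<integral>\<omega>. (\<Sum>t=1..T. noise t \<omega>)\<^sup>2 \<partial>M) \<le> real T * (\<Sum>j\<in>UNIV. S j)"
proof -
  have int: "integrable M (\<lambda>\<omega>. noise s \<omega> * noise t \<omega>)" if "s \<in> {1..T}" "t \<in> {1..T}" for s t
    using noise_orthogonal(1)[OF that] noise_orthogonal(1)[OF that(2,1)] noise_square(1)[OF that(1)]
    by (cases s t rule: linorder_cases) (simp_all add: mult.commute power2_eq_square)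
  note * = integral_square_orthogonal_sum[OF finite_atLeastAtMost int noise_orthogonal(2)]
  show "integrable M (\<lambda>\<omega>. (\<Sum>t=1..T. noise t \<omega>)\<^sup>2)"
    by (rule *(1))
  have "(\<Sum>t=1..T. \<integral>\<omega>. (noise t \<omega>)\<^sup>2 \<partial>M) \<le> (\<Sum>t=1..T. \<Sum>j\<in>UNIV. S j)"
    by (intro sum_mono noise_square)
  then show "(\<integral>\<omega>. (\<Sum>t=1..T. noise t \<omega>)\<^sup>2 \<partial>M) \<le> real T * (\<Sum>j\<in>UNIV. S j)"
    by (subst *(2)) simp_all
qed

lemma reward_orthogonal:
  assumes s: "s \<in> {1..T}" and t: "t \<in> {1..T}" and st: "s < t"
  shows "integrable M (\<lambda>\<omega>. (r s \<omega> $ j - m j) * (r t \<omega> $ j - m j))"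
    and "(\<integral>\<omega>. (r s \<omega> $ j - m j) * (r t \<omega> $ j - m j) \<partial>M) = 0"
proof -
  have T: "1 \<le> T" using t by auto
  have s': "s \<in> {1..<t}" using s st by auto
  have u: "(\<lambda>x. x s $ j - m j) \<in> borel_measurable (\<Pi>\<^sub>M s\<in>{1..<t}. borel)"
    by (intro borel_measurable_diff borel_measurable_const
        measurable_compose[OF measurable_component_singleton[OF s'] borel_measurable_vec_nth])
  have int: "integrable M (\<lambda>\<omega>. (\<lambda>s\<in>{1..<t}. r s \<omega>) s $ j - m j)"
    using s' integrable_reward_iff[OF s, of "\<lambda>x. x $ j - m j"] integrable_centred[of j]
    by simp
  have v: "(\<lambda>x. x $ j - m j) \<in> borel_measurable borel" by measurable
  \<comment> \<open>With \<open>n = 0\<close> the condition on the arms is empty, and the claim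
    concerns the rewards alone.\<close>
  note * = expectation_path[OF t v integrable_centred integral_centred[OF T] u int le0]
  show "integrable M (\<lambda>\<omega>. (r s \<omega> $ j - m j) * (r t \<omega> $ j - m j))"
    and "(\<integral>\<omega>. (r s \<omega> $ j - m j) * (r t \<omega> $ j - m j) \<partial>M) = 0"
    using * s' by simp_all
qed

lemma reward_second_moment:
  shows "integrable M (\<lambda>\<omega>. (\<Sum>t=1..T. r t \<omega> $ j - m j)\<^sup>2)"
    and "(\<integral>\<omega>. (\<Sum>t=1..T. r t \<omega> $ j - m j)\<^sup>2 \<partial>M) = real T * S j"
proof -
  have int: "integrable M (\<lambda>\<omega>. (r s \<omega> $ j - m j) * (r t \<omega> $ j - m j))"
    if "s \<in> {1..T}" "t \<in> {1..T}" for s t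
    using reward_orthogonal(1)[OF that] reward_orthogonal(1)[OF that(2,1)]
      integrable_reward_centred_square[OF that(1)]
    by (cases s t rule: linorder_cases) (simp_all add: mult.commute power2_eq_square)
  note * = integral_square_orthogonal_sum[OF finite_atLeastAtMost int reward_orthogonal(2)]
  show "integrable M (\<lambda>\<omega>. (\<Sum>t=1..T. r t \<omega> $ j - m j)\<^sup>2)"
    by (rule *(1))
  have "(\<integral>\<omega>. (r t \<omega> $ j - m j)\<^sup>2 \<partial>M) = S j" if "t \<in> {1..T}" for t
    by (rule expectation_reward[OF that]) measurable
  then show "(\<integral>\<omega>. (\<Sum>t=1..T. r t \<omega> $ j - m j)\<^sup>2 \<partial>M) = real T * S j"
    by (subst *(2)) simp_all
qed

section \<open>The potential bound in expectation\<close>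

lemma integrable_collected:
  assumes t: "t \<in> {1..T}"
  shows "integrable M (\<lambda>\<omega>. r t \<omega> $ i t \<omega>)"
  by (rule integrable_drawn[OF t]) (subst integrable_reward_iff[OF t], auto intro: integrable_coordinate)

text \<open>In every importance-weighted term the probability of the draw cancels the single factor
  \<open>1 / p\<close> exactly, however small \<open>p\<close> becomes, so each such sum turns into
  \<open>T\<close> times a moment under \<open>D\<close>.\<close>

lemma expectation_log_potential:
  assumes \<alpha>: "0 \<le> \<alpha>" and T: "1 \<le> T"
    and B: "\<alpha> / (3 * sqrt (real CARD('k) * real T)) \<le> B"
  defines "\<eta> \<equiv> \<gamma> / (3 * real CARD('k))"
  shows "(1 - \<gamma>) * (\<eta> * (real T * m l) - ln (real CARD('k))) \<le>
    real T * (exp B * (\<eta> * \<alpha> / sqrt (real CARD('k) * real T)) * (\<Sum>j\<in>UNIV. \<integral>x. U j x \<partial>D))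
    + \<eta> * (\<integral>\<omega>. (\<Sum>t=1..T. r t \<omega> $ i t \<omega>) \<partial>M)
    - \<eta> * \<gamma> / real CARD('k) * (real T * (\<Sum>j\<in>UNIV. m j))
    + \<eta>\<^sup>2 * (real T * (\<Sum>j\<in>UNIV. \<integral>x. V j x \<partial>D))"
proof -
  define c where "c = exp B * (\<eta> * \<alpha> / sqrt (real CARD('k) * real T))"
  define X where "X = (\<lambda>t j \<omega>. r t \<omega> $ j / p t j \<omega> * of_bool (j = i t \<omega>))"
  define Y where "Y = (\<lambda>t j \<omega>. V j (r t \<omega>) / p t j \<omega> * of_bool (j = i t \<omega>))"
  define Z where "Z = (\<lambda>t j \<omega>. U j (r t \<omega>))"
  define G where "G = (\<lambda>t \<omega>. r t \<omega> $ i t \<omega>)"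
  have X: "integrable M (X t j)" "(\<integral>\<omega>. X t j \<omega> \<partial>M) = m j" if "t \<in> {1..T}" for t j
    unfolding X_def
    by (rule integrable_importance_weighted[OF that borel_measurable_vec_nth integrable_coordinate]
        expectation_importance_weighted[OF that borel_measurable_vec_nth integrable_coordinate])+
  have Y: "integrable M (Y t j)" "(\<integral>\<omega>. Y t j \<omega> \<partial>M) = (\<integral>x. V j x \<partial>D)" if "t \<in> {1..T}" for t j
    unfolding Y_def
    by (rule integrable_importance_weighted[OF that _ integrable_V]
        expectation_importance_weighted[OF that _ integrable_V], measurable)+
  have Z: "integrable M (Z t j)" "(\<integral>\<omega>. Z t j \<omega> \<partial>M) = (\<integral>x. U j x \<partial>D)" if "t \<in> {1..T}" for t j
    unfolding Z_def using integrable_U[of j] expectation_reward[OF that, of "U j"]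
      integrable_reward_iff[OF that, of "U j"] by simp_all
  have G: "integrable M (G t)" if "t \<in> {1..T}" for t
    unfolding G_def by (rule integrable_collected[OF that])
  have bound: "(1 - \<gamma>) * (\<eta> * (\<Sum>t=1..T. X t l \<omega>) - ln (real CARD('k))) \<le>
      (\<Sum>t=1..T. \<Sum>j\<in>UNIV. c * Z t j \<omega>) + \<eta> * (\<Sum>t=1..T. G t \<omega>)
      - \<eta> * \<gamma> / real CARD('k) * (\<Sum>t=1..T. \<Sum>j\<in>UNIV. X t j \<omega>)
      + \<eta>\<^sup>2 * (\<Sum>t=1..T. \<Sum>j\<in>UNIV. Y t j \<omega>)" for \<omega>
    unfolding X_def Y_def Z_def G_def c_def \<eta>_def
    by (rule exp3p_log_potential[OF \<gamma> \<alpha> T B])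
  have iX: "integrable M (\<lambda>\<omega>. \<Sum>t=1..T. \<Sum>j\<in>UNIV. X t j \<omega>)"
    and iY: "integrable M (\<lambda>\<omega>. \<Sum>t=1..T. \<Sum>j\<in>UNIV. Y t j \<omega>)"
    and iZ: "integrable M (\<lambda>\<omega>. \<Sum>t=1..T. \<Sum>j\<in>UNIV. c * Z t j \<omega>)"
    and iG: "integrable M (\<lambda>\<omega>. \<Sum>t=1..T. G t \<omega>)"
    and il: "integrable M (\<lambda>\<omega>. \<Sum>t=1..T. X t l \<omega>)"
    using X Y Z G by (auto intro!: Bochner_Integration.integrable_sum integrable_mult_right)
  have eX: "(\<integral>\<omega>. (\<Sum>t=1..T. \<Sum>j\<in>UNIV. X t j \<omega>) \<partial>M) = real T * (\<Sum>j\<in>UNIV. m j)"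
    and eY: "(\<integral>\<omega>. (\<Sum>t=1..T. \<Sum>j\<in>UNIV. Y t j \<omega>) \<partial>M) = real T * (\<Sum>j\<in>UNIV. \<integral>x. V j x \<partial>D)"
    and eZ: "(\<integral>\<omega>. (\<Sum>t=1..T. \<Sum>j\<in>UNIV. c * Z t j \<omega>) \<partial>M) = real T * (c * (\<Sum>j\<in>UNIV. \<integral>x. U j x \<partial>D))"
    and el: "(\<integral>\<omega>. (\<Sum>t=1..T. X t l \<omega>) \<partial>M) = real T * m l"
    using X Y Z
    by (simp_all add: Bochner_Integration.integral_sum Bochner_Integration.integrable_sum
        flip: sum_distrib_left)
  have linear: "(\<integral>\<omega>. F1 \<omega> + c2 * F2 \<omega> - c3 * F3 \<omega> + c4 * F4 \<omega> \<partial>M) =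
      (\<integral>\<omega>. F1 \<omega> \<partial>M) + c2 * (\<integral>\<omega>. F2 \<omega> \<partial>M) - c3 * (\<integral>\<omega>. F3 \<omega> \<partial>M) + c4 * (\<integral>\<omega>. F4 \<omega> \<partial>M)"
    if "integrable M F1" "integrable M F2" "integrable M F3" "integrable M F4"
    for F1 F2 F3 F4 :: "'w \<Rightarrow> real" and c2 c3 c4
    using that by simp
  have "(1 - \<gamma>) * (\<eta> * (real T * m l) - ln (real CARD('k))) =
      (\<integral>\<omega>. (1 - \<gamma>) * (\<eta> * (\<Sum>t=1..T. X t l \<omega>) - ln (real CARD('k))) \<partial>M)"
    using il by (simp add: el prob_space del: One_nat_def)
  also have "\<dots> \<le> (\<integral>\<omega>. (\<Sum>t=1..T. \<Sum>j\<in>UNIV. c * Z t j \<omega>) + \<eta> * (\<Sum>t=1..T. G t \<omega>)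
      - \<eta> * \<gamma> / real CARD('k) * (\<Sum>t=1..T. \<Sum>j\<in>UNIV. X t j \<omega>)
      + \<eta>\<^sup>2 * (\<Sum>t=1..T. \<Sum>j\<in>UNIV. Y t j \<omega>) \<partial>M)"
    by (intro integral_mono bound Bochner_Integration.integrable_add Bochner_Integration.integrable_diff
        integrable_mult_right iX iY iZ iG il integrable_const_bound[where B = "ln (real CARD('k))"]) auto
  also have "\<dots> = real T * (c * (\<Sum>j\<in>UNIV. \<integral>x. U j x \<partial>D)) + \<eta> * (\<integral>\<omega>. (\<Sum>t=1..T. G t \<omega>) \<partial>M)
      - \<eta> * \<gamma> / real CARD('k) * (real T * (\<Sum>j\<in>UNIV. m j))
      + \<eta>\<^sup>2 * (real T * (\<Sum>j\<in>UNIV. \<integral>x. V j x \<partial>D))"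
    by (simp only: linear[OF iZ iG iX iY] eX eY eZ)
  finally show ?thesis unfolding c_def G_def .
qed

end

section \<open>The regret bound\<close>

text \<open>The pointwise bound \<open>\<bar>X\<bar> \<le> s + X\<^sup>2 / s\<close> takes the place
  of Cauchy-Schwarz: with \<open>s = sqrt T\<close>, a second moment \<open>O(T)\<close> gives a
  mean \<open>O(sqrt T)\<close> that is linear in \<open>v\<close>.\<close>

lemma (in prob_space) integral_abs_le_second_moment:
  fixes X :: "'a \<Rightarrow> real"
  assumes "integrable M X" "integrable M (\<lambda>\<omega>. (X \<omega>)\<^sup>2)" and s: "s > 0"
    and "(\<integral>\<omega>. (X \<omega>)\<^sup>2 \<partial>M) \<le> s\<^sup>2 * v"
  shows "(\<integral>\<omega>. \<bar>X \<omega>\<bar> \<partial>M) \<le> s * (1 + v)"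
proof -
  have "\<bar>X \<omega>\<bar> \<le> s + (X \<omega>)\<^sup>2 / s" for \<omega>
  proof -
    have "0 \<le> \<bar>X \<omega>\<bar> * s" using s by simp
    then have "\<bar>X \<omega>\<bar> * s \<le> s\<^sup>2 + \<bar>X \<omega>\<bar>\<^sup>2"
      using sum_squares_bound[of "\<bar>X \<omega>\<bar>" s] by linarith
    then show ?thesis
      using s by (simp add: field_simps power2_eq_square)
  qed
  then have "(\<integral>\<omega>. \<bar>X \<omega>\<bar> \<partial>M) \<le> (\<integral>\<omega>. s + (X \<omega>)\<^sup>2 / s \<partial>M)"
    using assms by (intro integral_mono) auto
  also have "\<dots> = s + (\<integral>\<omega>. (X \<omega>)\<^sup>2 \<partial>M) / s"
    using assms by (simp add: prob_space)
  also have "\<dots> \<le> s + (s\<^sup>2 * v) / s"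
    using assms by (intro add_left_mono divide_right_mono) auto
  also have "\<dots> = s * (1 + v)"
    using s by (simp add: power2_eq_square distrib_left)
  finally show ?thesis .
qed

lemma regret_le_iff:
  "regret T r i \<le> c \<longleftrightarrow> (\<forall>j. (\<Sum>t=1..T. r t $ j) - (\<Sum>t=1..T. r t $ i t) \<le> c)"
  unfolding regret_def by (simp add: diff_le_eq)

context exp3p_process
begin

lemma sets_regret_le:
  "{\<omega> \<in> space M. regret T (\<lambda>t. r t \<omega>) (\<lambda>t. i t \<omega>) \<le> c} \<in> sets M"
proof -
  have [measurable]: "(\<lambda>\<omega>. r t \<omega> $ j) \<in> borel_measurable M" if "t \<in> {1..T}" for t j
    by (rule measurable_compose[OF measurable_r[OF that] borel_measurable_vec_nth])
  have [measurable]: "(\<lambda>\<omega>. r t \<omega> $ i t \<omega>) \<in> borel_measurable M" if "t \<in> {1..T}" for t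
    using integrable_collected[OF that] by (rule borel_measurable_integrable)
  show ?thesis
    unfolding regret_le_iff by measurable
qed

text \<open>The integrated potential bound, divided by \<open>\<eta>\<close>. The terms in
  \<open>\<gamma> * T\<close> and \<open>1 / \<gamma>\<close> balance for \<open>\<gamma>\<close> of
  order \<open>1 / sqrt T\<close>, and the bonus contributes order
  \<open>\<alpha> * sqrt T\<close>.\<close>

lemma expected_reward_ge:
  assumes \<alpha>: "0 \<le> \<alpha>" and T: "1 \<le> T"
    and B: "\<alpha> / (3 * sqrt (real CARD('k) * real T)) \<le> B"
  shows "real T * m l - (\<integral>\<omega>. (\<Sum>t=1..T. r t \<omega> $ i t \<omega>) \<partial>M) \<le>
    \<gamma> * real T * (2 * (\<Sum>j\<in>UNIV. \<bar>m j\<bar>)) + 3 * real CARD('k) * ln (real CARD('k)) / \<gamma> +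
    exp B * \<alpha> * sqrt (real T) * (\<Sum>j\<in>UNIV. \<integral>x. U j x \<partial>D) +
    \<gamma> * real T * (\<Sum>j\<in>UNIV. \<integral>x. V j x \<partial>D)"
proof -
  define K where "K = real CARD('k)"
  define \<eta> where "\<eta> = \<gamma> / (3 * K)"
  define EU EV E A Ab where "EU = (\<Sum>j\<in>UNIV. \<integral>x. U j x \<partial>D)"
    and "EV = (\<Sum>j\<in>UNIV. \<integral>x. V j x \<partial>D)"
    and "E = (\<integral>\<omega>. (\<Sum>t=1..T. r t \<omega> $ i t \<omega>) \<partial>M)"
    and "A = (\<Sum>j\<in>UNIV. m j)" and "Ab = (\<Sum>j\<in>UNIV. \<bar>m j\<bar>)"
  have K: "1 \<le> K" by (simp add: K_def Suc_le_eq)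
  have \<eta>: "0 < \<eta>" using \<gamma> K by (simp add: \<eta>_def)
  have EU: "0 \<le> EU" and EV: "0 \<le> EV" unfolding EU_def EV_def by (auto intro!: sum_nonneg)
  have Ab: "m l \<le> Ab" "- A \<le> Ab" "0 \<le> Ab"
    unfolding Ab_def A_def
    using member_le_sum[of l UNIV "\<lambda>j. \<bar>m j\<bar>"] abs_le_D1[of "m l"] abs_le_D2[OF sum_abs[of m UNIV]]
    by (simp_all add: sum_nonneg)
  have AK: "- A / K \<le> Ab"
  proof -
    have "- A / K \<le> Ab / K" using Ab K by (intro divide_right_mono) auto
    also have "\<dots> \<le> Ab" using Ab K by (simp add: divide_le_eq mult_le_cancel_left1)
    finally show ?thesis .
  qed
  have "(1 - \<gamma>) * (\<eta> * (real T * m l) - ln K) \<le>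
    real T * (exp B * (\<eta> * \<alpha> / sqrt (K * real T)) * EU) + \<eta> * E
    - \<eta> * \<gamma> / K * (real T * A) + \<eta>\<^sup>2 * (real T * EV)"
    unfolding K_def \<eta>_def EU_def EV_def E_def A_def
    by (rule expectation_log_potential[OF \<alpha> T B])
  \<comment> \<open>The loss from the factor \<open>1 - \<gamma>\<close> and the subtracted
    exploration sum combine into \<open>m l - A / K\<close>, the gap between arm \<open>l\<close>
    and uniform play.\<close>
  then have "\<eta> * (real T * m l - E) \<le> \<eta> * (\<gamma> * real T * (m l + - A / K)) + (1 - \<gamma>) * ln K +
      \<eta> * (exp B * \<alpha> * (real T / sqrt (K * real T)) * EU) + \<eta> * (\<eta> * real T * EV)"
    by (simp add: algebra_simps power2_eq_square)
  also have "\<gamma> * real T * (m l + - A / K) \<le> \<gamma> * real T * (2 * Ab)"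
    using Ab AK \<gamma> by (intro mult_left_mono) auto
  also have "(1 - \<gamma>) * ln K \<le> \<eta> * (3 * K * ln K / \<gamma>)"
    using \<gamma> K mult_left_le_one_le[of "ln K" "1 - \<gamma>"] by (simp add: \<eta>_def)
  also have "real T / sqrt (K * real T) \<le> sqrt (real T)"
  proof -
    have "real T / sqrt (K * real T) = sqrt (real T) / sqrt K"
      using T K real_sqrt_mult_self[of "real T"] by (simp add: real_sqrt_mult field_simps)
    also have "\<dots> \<le> sqrt (real T)" using K by (simp add: divide_le_eq mult_le_cancel_left1)
    finally show ?thesis .
  qed
  also have "\<eta> * real T * EV \<le> \<gamma> * real T * EV"
    using \<gamma> K EV by (intro mult_right_mono) (auto simp: \<eta>_def divide_le_eq mult_le_cancel_left1)
  finally have "\<eta> * (real T * m l - E) \<le> \<eta> * (\<gamma> * real T * (2 * Ab)) + \<eta> * (3 * K * ln K / \<gamma>) +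
      \<eta> * (exp B * \<alpha> * sqrt (real T) * EU) + \<eta> * (\<gamma> * real T * EV)"
    using \<eta> \<alpha> EU by (simp add: mult_left_mono mult_right_mono)
  then have "\<eta> * (real T * m l - E) \<le> \<eta> * (\<gamma> * real T * (2 * Ab) + 3 * K * ln K / \<gamma> +
      exp B * \<alpha> * sqrt (real T) * EU + \<gamma> * real T * EV)"
    by (simp only: distrib_left)
  then show ?thesis
    using \<eta> unfolding K_def EU_def EV_def E_def Ab_def by simp
qed

text \<open>
  The regret is dominated by the nonnegative pseudo-regret plus fluctuations of order
  \<open>sqrt T\<close>, so that Markov's inequality applies, although the regret itself may be negative.
\<close>

lemma prob_regret_ge:
  assumes T: "1 \<le> T" and \<delta>: "0 < \<delta>"
    and Q: "\<And>l. real T * m l - (\<integral>\<omega>. (\<Sum>t=1..T. r t \<omega> $ i t \<omega>) \<partial>M) \<le> Q"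
    and c: "Q + sqrt (real T) * (1 + real CARD('k) + 2 * (\<Sum>j\<in>UNIV. S j)) \<le> \<delta> * c" and "0 < c"
  shows "1 - \<delta> \<le> prob {\<omega> \<in> space M. regret T (\<lambda>t. r t \<omega>) (\<lambda>t. i t \<omega>) \<le> c}"
proof -
  obtain l where l: "\<And>j. m j \<le> m l"
  proof -
    have "Max (range m) \<in> range m" by (rule Max_in) auto
    then obtain l where "m l = Max (range m)" by (metis rangeE)
    then have "m j \<le> m l" for j by (simp add: Max_ge)
    then show ?thesis using that by blast
  qed
  define P where "P = (\<lambda>\<omega>. \<Sum>t=1..T. m l - m (i t \<omega>))"
  define N where "N = (\<lambda>\<omega>. \<Sum>t=1..T. noise t \<omega>)"
  define F where "F = (\<lambda>j \<omega>. \<Sum>t=1..T. r t \<omega> $ j - m j)"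
  define Z where "Z = (\<lambda>\<omega>. P \<omega> + \<bar>N \<omega>\<bar> + (\<Sum>j\<in>UNIV. \<bar>F j \<omega>\<bar>))"
  have iP: "integrable M P"
    unfolding P_def
    by (rule Bochner_Integration.integrable_sum, rule integrable_drawn[where g = "\<lambda>j _. m l - m j"]) auto
  have iN: "integrable M N"
    unfolding N_def by (intro Bochner_Integration.integrable_sum noise_mean_zero)
  have iF: "integrable M (F j)" for j
    unfolding F_def
    by (intro Bochner_Integration.integrable_sum, subst integrable_reward_iff)
       (auto intro: integrable_centred)
  have iZ: "integrable M Z"
    unfolding Z_def using iP iN iF by auto
  have P_nonneg: "0 \<le> P \<omega>" for \<omega> unfolding P_def using l by (intro sum_nonneg) simp
  have Z_nonneg: "0 \<le> Z \<omega>" for \<omega> unfolding Z_def using P_nonneg by (intro add_nonneg_nonneg sum_nonneg) auto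
  have regret_le: "regret T (\<lambda>t. r t \<omega>) (\<lambda>t. i t \<omega>) \<le> Z \<omega>" for \<omega>
    unfolding regret_le_iff
  proof
    fix j
    \<comment> \<open>Regret against arm \<open>j\<close> splits into the fluctuation of that arm,
      the noise, the pseudo-regret relative to the best mean, and a nonpositive gap; the sum over
      all arms in \<open>Z\<close> covers every \<open>j\<close> at once.\<close>
    have "(\<Sum>t=1..T. r t \<omega> $ j) - (\<Sum>t=1..T. r t \<omega> $ i t \<omega>) =
        F j \<omega> - N \<omega> + P \<omega> + real T * (m j - m l)"
      by (simp add: F_def N_def P_def sum_subtractf algebra_simps)
    moreover have "real T * (m j - m l) \<le> 0" using l by (simp add: mult_nonneg_nonpos)
    moreover have "\<bar>F j \<omega>\<bar> \<le> (\<Sum>j\<in>UNIV. \<bar>F j \<omega>\<bar>)" by (rule member_le_sum) auto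
    ultimately show "(\<Sum>t=1..T. r t \<omega> $ j) - (\<Sum>t=1..T. r t \<omega> $ i t \<omega>) \<le> Z \<omega>"
      unfolding Z_def by linarith
  qed
  have EP: "(\<integral>\<omega>. P \<omega> \<partial>M) \<le> Q"
  proof -
    let ?G = "\<lambda>\<omega>. \<Sum>t=1..T. r t \<omega> $ i t \<omega>"
    have iG: "integrable M ?G" by (intro Bochner_Integration.integrable_sum integrable_collected)
    have "(\<integral>\<omega>. N \<omega> \<partial>M) = (\<Sum>t=1..T. \<integral>\<omega>. noise t \<omega> \<partial>M)"
      unfolding N_def by (intro Bochner_Integration.integral_sum noise_mean_zero)
    then have EN: "(\<integral>\<omega>. N \<omega> \<partial>M) = 0" by (simp add: noise_mean_zero(2))
    \<comment> \<open>As the noise has mean zero, the expected pseudo-regret is the expected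
      shortfall of the collected reward, the quantity bounded by \<open>Q\<close>.\<close>
    have "P \<omega> = real T * m l - ?G \<omega> + N \<omega>" for \<omega>
      by (simp add: P_def N_def sum_subtractf)
    then have "(\<integral>\<omega>. P \<omega> \<partial>M) = real T * m l - (\<integral>\<omega>. ?G \<omega> \<partial>M)"
      using iG iN EN by (simp add: prob_space del: One_nat_def)
    also have "\<dots> \<le> Q" by (rule Q)
    finally show ?thesis .
  qed
  have sT: "0 < sqrt (real T)" "(sqrt (real T))\<^sup>2 = real T" using T by auto
  have EN: "(\<integral>\<omega>. \<bar>N \<omega>\<bar> \<partial>M) \<le> sqrt (real T) * (1 + (\<Sum>j\<in>UNIV. S j))"
    using noise_second_moment sT
    by (intro integral_abs_le_second_moment iN) (simp_all add: N_def)
  have EF: "(\<integral>\<omega>. \<bar>F j \<omega>\<bar> \<partial>M) \<le> sqrt (real T) * (1 + S j)" for j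
    using reward_second_moment[of j] sT
    by (intro integral_abs_le_second_moment iF) (simp_all add: F_def)
  have "(\<integral>\<omega>. Z \<omega> \<partial>M) = (\<integral>\<omega>. P \<omega> \<partial>M) + (\<integral>\<omega>. \<bar>N \<omega>\<bar> \<partial>M) + (\<Sum>j\<in>UNIV. \<integral>\<omega>. \<bar>F j \<omega>\<bar> \<partial>M)"
    unfolding Z_def using iP iN iF by simp
  also have "\<dots> \<le> Q + sqrt (real T) * (1 + (\<Sum>j\<in>UNIV. S j)) + (\<Sum>j\<in>UNIV. sqrt (real T) * (1 + S j))"
    by (intro add_mono EP EN sum_mono EF)
  also have "\<dots> = Q + sqrt (real T) * (1 + real CARD('k) + 2 * (\<Sum>j\<in>UNIV. S j))"
    by (simp add: sum.distrib algebra_simps flip: sum_distrib_left)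
  also have "\<dots> \<le> \<delta> * c" by (rule c)
  finally have EZ: "(\<integral>\<omega>. Z \<omega> \<partial>M) \<le> \<delta> * c" .
  have "prob {\<omega> \<in> space M. Z \<omega> \<ge> c} \<le> (\<integral>\<omega>. Z \<omega> \<partial>M) / c"
    using integral_Markov_inequality_measure[OF iZ sets.empty_sets] Z_nonneg \<open>0 < c\<close> by simp
  also have "\<dots> \<le> \<delta>" using EZ \<open>0 < c\<close> by (simp add: divide_le_eq)
  finally have "1 - \<delta> \<le> 1 - prob {\<omega> \<in> space M. Z \<omega> \<ge> c}" by simp
  also have "\<dots> = prob (space M - {\<omega> \<in> space M. Z \<omega> \<ge> c})"
    using iZ by (intro prob_compl[symmetric]) simp
  also have "\<dots> \<le> prob {\<omega> \<in> space M. regret T (\<lambda>t. r t \<omega>) (\<lambda>t. i t \<omega>) \<le> c}"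
    by (intro finite_measure_mono sets_regret_le) (auto intro: order_trans[OF regret_le])
  finally show ?thesis .
qed

end

text \<open>The exponent \<open>k = 1\<close> suffices, since
  \<open>ln (\<kappa> * T) = ln \<kappa> + 2 * ln (sqrt T)\<close> for
  \<open>T \<ge> 1\<close>.\<close>

lemma sqrt_log_in_bigostar:
  fixes c1 c2 \<kappa> :: real
  assumes \<kappa>: "\<kappa> > 0"
  shows "(\<lambda>T. sqrt (real T) * (c1 + c2 * ln (\<kappa> * real T))) \<in> bigostar (\<lambda>T. sqrt (real T))"
proof -
  have "(\<lambda>T. ln (\<kappa> * real T)) \<in> O(\<lambda>T. ln (sqrt (real T)))" "(\<lambda>T. 1) \<in> O(\<lambda>T. ln (sqrt (real T)))"
    using \<kappa> by real_asymp+
  then have "(\<lambda>T. c1 + c2 * ln (\<kappa> * real T)) \<in> O(\<lambda>T. ln (sqrt (real T)))"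
    using landau_o.big_trans[OF bigo_const[of c1]] landau_o.big.mult[OF bigo_const[of c2]]
    by (intro sum_in_bigo(1)) auto
  then have "(\<lambda>T. sqrt (real T) * (c1 + c2 * ln (\<kappa> * real T))) \<in>
      O(\<lambda>T. sqrt (real T) * ln (sqrt (real T)) powi 1)"
    by (intro landau_o.big.mult) simp_all
  then show ?thesis unfolding bigostar_def by blast
qed

section \<open>Choice of the constants and conclusion\<close>

theorem theorem9:
  fixes f :: "real ^ 'k \<Rightarrow> real" and \<mu> :: "real ^ 'k" and C :: "real ^ 'k ^ 'k"
    and a \<delta> :: real
  assumes "subgaussian_mab f \<mu> C" and "a > 2" and "0 < \<delta>" and "\<delta> < 1"
  shows "\<exists>h \<in> bigostar (\<lambda>T. sqrt (real T)). \<forall>T\<ge>1. \<forall>\<gamma> \<alpha>.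
           \<gamma> = 2 * sqrt (3 * real CARD('k) * ln (real CARD('k)) / (5 * real T)) \<longrightarrow>
           \<alpha> = 2 * sqrt (ln (real CARD('k) * real T / \<delta>)) \<longrightarrow>
           \<gamma> \<in> {0<..<1} \<longrightarrow>
           (\<forall>(M :: 'w measure) (r :: nat \<Rightarrow> 'w \<Rightarrow> real ^ 'k) (i :: nat \<Rightarrow> 'w \<Rightarrow> 'k).
              exp3p_run M f \<alpha> \<gamma> T r i \<longrightarrow>
              measure M {\<omega> \<in> space M.
                  regret T (\<lambda>t. r t \<omega>) (\<lambda>t. i t \<omega>) \<le> ln (1 / \<delta>) * h T}
                \<ge> (1 - \<delta>) * (1 - 1 / real T powr a) ^ T)"
proof -
  define D where "D = density lborel (\<lambda>x. ennreal (f x))"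
  define K where "K = real CARD('k)"
  define m where "m = (\<lambda>j. \<integral>x. x $ j \<partial>D)"
  define Ab where "Ab = (\<Sum>j\<in>UNIV. \<bar>m j\<bar>)"
  define S where "S = (\<Sum>j\<in>UNIV. \<integral>x. (x $ j - m j)\<^sup>2 \<partial>D)"
  define EU where "EU = (\<Sum>j\<in>UNIV. \<integral>x. exp (\<bar>x $ j\<bar> / 3) \<partial>D)"
  define EV where "EV = (\<Sum>j\<in>UNIV. \<integral>x. (x $ j)\<^sup>2 * exp (\<bar>x $ j\<bar> / 3) \<partial>D)"
  \<comment> \<open>From \<open>ln x \<le> x\<close> at \<open>x = K * T / \<delta>\<close> follows
    \<open>\<alpha> \<le> 2 * sqrt (K * T / \<delta>)\<close>, so this \<open>B\<close> bounds the
    bonus exponent uniformly in \<open>T\<close>.\<close>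
  define B where "B = 2 / (3 * sqrt \<delta>)"
  define g where "g = 2 * sqrt (3 * K * ln K / 5)"
  \<comment> \<open>Substituting \<open>\<gamma> = g / sqrt T\<close> and
    \<open>\<alpha> \<le> 1 + ln (K * T / \<delta>)\<close> into \<open>expected_reward_ge\<close>,
    and adding the fluctuations from \<open>prob_regret_ge\<close>, gives
    \<open>sqrt T * (c1 + c2 * ln (K * T / \<delta>))\<close>.\<close>
  define c1 where "c1 = 2 * g * Ab + 3 * K * ln K / g + exp B * EU + g * EV + (1 + K + 2 * S)"
  define c2 where "c2 = exp B * EU"
  define L where "L = ln (1 / \<delta>)"
  \<comment> \<open>Division by \<open>\<delta> * L\<close> makes
    \<open>\<delta> * (L * h T)\<close> equal to that bound, as Markov's inequality with failure
    probability \<open>\<delta>\<close> requires; both divisors are constant in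
    \<open>T\<close>.\<close>
  define h where "h = (\<lambda>T. sqrt (real T) * (c1 / (\<delta> * L) + c2 / (\<delta> * L) * ln (K / \<delta> * real T)))"
  have \<delta>: "0 < \<delta>" "\<delta> < 1" by fact+
  have K: "1 \<le> K" by (simp add: K_def Suc_le_eq)
  have L: "0 < L" using \<delta> by (simp add: L_def)
  have EU: "0 \<le> EU" by (auto simp: EU_def intro!: sum_nonneg)
  have EV: "0 \<le> EV" by (auto simp: EV_def intro!: sum_nonneg)
  have S: "0 \<le> S" by (auto simp: S_def intro!: sum_nonneg)
  have Ab: "0 \<le> Ab" by (auto simp: Ab_def intro!: sum_nonneg)
  have exp_moment: "integrable D (\<lambda>x. exp \<bar>x $ j\<bar>)" for j
  proof -
    have "prob_space D" "\<exists>\<sigma>>0. subgaussian D (\<lambda>x. x $ j) \<sigma>"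
      using assms(1) unfolding subgaussian_mab_def Let_def D_def by blast+
    then show ?thesis using subgaussian_integrable_exp_abs by blast
  qed
  have "h \<in> bigostar (\<lambda>T. sqrt (real T))"
    unfolding h_def using K \<delta> by (intro sqrt_log_in_bigostar) simp
  moreover have "(1 - \<delta>) * (1 - 1 / real T powr a) ^ T \<le>
      measure M {\<omega> \<in> space M. regret T (\<lambda>t. r t \<omega>) (\<lambda>t. i t \<omega>) \<le> L * h T}"
    if T: "1 \<le> T" and \<gamma>_eq: "\<gamma> = 2 * sqrt (3 * K * ln K / (5 * real T))"
      and \<alpha>_eq: "\<alpha> = 2 * sqrt (ln (K * real T / \<delta>))" and \<gamma>01: "\<gamma> \<in> {0<..<1}"
      and run: "exp3p_run M f \<alpha> \<gamma> T r i"
    for T \<gamma> \<alpha> and M :: "'w measure" and r :: "nat \<Rightarrow> 'w \<Rightarrow> real ^ 'k" and i :: "nat \<Rightarrow> 'w \<Rightarrow> 'k"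
  proof -
    interpret exp3p_process M f \<alpha> \<gamma> T r i
      using run \<gamma>01 exp_moment by unfold_locales (auto simp: D_def)
    define s where "s = sqrt (real T)"
    define l where "l = ln (K * real T / \<delta>)"
    have s: "0 < s" "s * s = real T" using T by (auto simp: s_def)
    have \<gamma>g: "\<gamma> = g / s"
      using T by (simp add: \<gamma>_eq g_def s_def real_sqrt_divide real_sqrt_mult)
    \<comment> \<open>Positivity of \<open>\<gamma>\<close> excludes a single arm, for which
      \<open>ln K\<close>, and hence \<open>g\<close>, would be 0; the division by \<open>g\<close>
      in \<open>c1\<close> is therefore genuine.\<close>
    have g: "0 < g" using \<gamma>01 \<gamma>g s by (simp add: zero_less_divide_iff)
    have KT: "1 \<le> K * real T / \<delta>"
    proof -
      have "1 * 1 \<le> K * real T" using K T by (intro mult_mono) auto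
      then show ?thesis using \<delta> by (simp add: le_divide_eq)
    qed
    have l: "0 \<le> l" using KT by (simp add: l_def)
    have \<alpha>0: "0 \<le> \<alpha>" and \<alpha>l: "\<alpha> \<le> 1 + l"
    proof -
      show "0 \<le> \<alpha>" using l by (simp add: \<alpha>_eq l_def)
      have "0 \<le> (sqrt l - 1)\<^sup>2" by simp
      then show "\<alpha> \<le> 1 + l" using l by (simp add: \<alpha>_eq l_def power2_diff)
    qed
    have \<alpha>B: "\<alpha> / (3 * sqrt (K * real T)) \<le> B"
    proof -
      have "l \<le> K * real T / \<delta>" using KT ln_le_minus_one[of "K * real T / \<delta>"] by (simp add: l_def)
      then have "\<alpha> \<le> 2 * sqrt (K * real T / \<delta>)" by (simp add: \<alpha>_eq l_def)
      then have "\<alpha> / (3 * sqrt (K * real T)) \<le> 2 * sqrt (K * real T / \<delta>) / (3 * sqrt (K * real T))"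
        using K by (intro divide_right_mono) auto
      also have "\<dots> = B" using K T by (simp add: B_def real_sqrt_divide)
      finally show ?thesis .
    qed
    define Q where "Q = \<gamma> * real T * (2 * Ab) + 3 * K * ln K / \<gamma> + exp B * \<alpha> * s * EU + \<gamma> * real T * EV"
    have Q: "real T * m j - (\<integral>\<omega>. (\<Sum>t=1..T. r t \<omega> $ i t \<omega>) \<partial>M) \<le> Q" for j
      using expected_reward_ge[OF \<alpha>0 T \<alpha>B[unfolded K_def], of j]
      by (simp only: Q_def m_def Ab_def EU_def EV_def D_def K_def s_def)
    have Q_le: "Q \<le> s * (2 * g * Ab + 3 * K * ln K / g + exp B * EU * (1 + l) + g * EV)"
    proof -
      have "exp B * \<alpha> * s * EU \<le> exp B * (1 + l) * s * EU"
        using \<alpha>l s EU by (intro mult_right_mono mult_left_mono) auto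
      moreover have "\<gamma> * real T = s * g" using s by (simp add: \<gamma>g s(2)[symmetric])
      moreover have "3 * K * ln K / \<gamma> = s * (3 * K * ln K / g)" by (simp add: \<gamma>g)
      ultimately show ?thesis by (simp add: Q_def algebra_simps)
    qed
    have L_h: "\<delta> * (L * h T) = s * (c1 + c2 * l)"
      using \<delta> L by (simp add: h_def s_def l_def field_simps)
    have c: "Q + sqrt (real T) * (1 + K + 2 * S) \<le> \<delta> * (L * h T)"
      unfolding L_h using Q_le by (simp add: c1_def c2_def s_def[symmetric] algebra_simps)
    have "0 \<le> c2" using EU by (simp add: c2_def)
    have "0 < c1"
    proof -
      have "0 \<le> g * Ab" "0 \<le> 3 * K * ln K / g" "0 \<le> exp B * EU" "0 \<le> g * EV"
        using g K EU EV Ab by simp_all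
      then show ?thesis unfolding c1_def using K S by linarith
    qed
    then have "0 < s * (c1 + c2 * l)"
      using s l \<open>0 \<le> c2\<close> by (intro mult_pos_pos add_pos_nonneg) auto
    then have pos: "0 < L * h T" using \<delta> unfolding L_h[symmetric] by (simp add: zero_less_mult_iff)
    \<comment> \<open>The \<open>T\<close>-th power in the target probability has its base in
      \<open>[0, 1]\<close>, so the target is at most the \<open>1 - \<delta>\<close> obtained from
      Markov's inequality.\<close>
    have "1 / real T powr a \<le> 1" "0 \<le> 1 / real T powr a"
      using T \<open>a > 2\<close> by (simp_all add: ge_one_powr_ge_zero)
    then have "(1 - \<delta>) * (1 - 1 / real T powr a) ^ T \<le> 1 - \<delta>"
      using \<delta> by (intro mult_left_le power_le_one) auto
    also have "\<dots> \<le> prob {\<omega> \<in> space M. regret T (\<lambda>t. r t \<omega>) (\<lambda>t. i t \<omega>) \<le> L * h T}"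
      by (rule prob_regret_ge[OF T \<delta>(1) Q[unfolded m_def D_def]
            c[unfolded S_def m_def D_def K_def] pos])
    finally show ?thesis .
  qed
  ultimately show ?thesis
    unfolding K_def L_def by blast
qed

end
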